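(* Let $u\in S_\infty$, let $k$ be a positive integer, and let $p$ be an integer with $p\le k$. Then $$\mathfrak{S}_u(x;y)\,E_{p,k}(x;z)=\sum_{w\in S_\infty:\ u\xrightarrow{k}w}E_{p-\ell(u,w),\,k-\ell(u,w)}\bigl(y_{P_k(u,w)};z\bigr)\,\mathfrak{S}_w(x;y).$$
   Context: **Permutations.** $\mathbb{N}=\{1,2,3,\dots\}$. $S_\infty$ is the group of bijections $\mathbb{N}\to\mathbb{N}$ fixing all but finitely many elements, with product $(uv)(i)=u(v(i))$ and identity $1$; $S_n\subset S_\infty$ is the subgroup of $u$ with $u(i)=i$ for $i>n$. $s_i$ ($i\ge 1$) is the transposition of $i$ and $i+1$; $t_{ab}=t_{ba}$ ($a\ne b$) is the transposition of $a$ and $b$. $\ell(u)$ is the number of pairs $i<j$ with $u(i)>u(j)$, and $\ell(u,w)=\ell(w)-\ell(u)$. **Double Schubert polynomials.** Work in the polynomial ring $\mathbb{Z}[x,y,z]$ in the variables $x_i,y_i,z_i$ ($i\in\mathbb{N}$). $s_i$ acts by the ring automorphism exchanging $x_i$ and $x_{i+1}$ and fixing all other variables. Put $\partial^{s_i}(P)=\frac{P-s_i(P)}{x_i-x_{i+1}}$, and $\partial^u=\partial^{s_{i_1}}\cdots\partial^{s_{i_m}}$ for any reduced word $u=s_{i_1}\cdots s_{i_m}$, $m=\ell(u)$ (independent of the choice). Let $w_0(n)\in S_{n+1}$ be given by $w_0(n)(i)=n+2-i$ for $i\le n+1$, and $\mathfrak{S}_{w_0(n)}(x;y)=\prod_{i,j\ge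 1,\ i+j\le n+1}(x_i-y_j)$. For $u\in S_{n+1}$, $\mathfrak{S}_u(x;y)=\partial^{u^{-1}w_0(n)}(\mathfrak{S}_{w_0(n)}(x;y))$ (independent of $n$). $\mathfrak{S}_v(x;z)$ is obtained by replacing each $y_j$ by $z_j$. **Factorial elementary symmetric polynomials.** For $0\le p\le k$ let $c_{p,k}=s_{k+1-p}s_{k+2-p}\cdots s_k$ (the identity if $p=0$) and $E_{p,k}(x;z)=\mathfrak{S}_{c_{p,k}}(x;z)$; among the $x$ variables only $x_1,\dots,x_k$ occur in it. If $p<0$ or $p>k$, $E_{p,k}(x;z)=0$. If $A$ is a finite set of positive integers with elements $a_1<\dots<a_m$, then $E_{q,m}(y_A;z)$ denotes $E_{q,m}(x;z)$ with $x_i$ replaced by $y_{a_i}$ for $1\le i\le m$. **The relation $\xrightarrow{k}$.** For $u,u'\in S_\infty$ and a positive integer $k$, write $u\xrightarrow{k}u'$ if there exist $r$ with $0\le r\le k$ and transpositions $t_{a_1b_1},\dots,t_{a_rb_r}$ such that (1) $a_i\le k<b_i$ for all $i$; (2) $a_i\ne a_j$ for $i\neq j$; (3) $\ell(ut_{a_1b_1}\cdots t_{a_ib_i})=\ell(u)+i$ for all $i$; (4) $u'=ut_{a_1b_1}\cdots t_{a_rb_r}$. If $u\xrightarrow{k}w$, let $P_k(u,w)=\{u(i)\mid i\le k,\ u(i)=w(i)\}$; this set has exactly $k-\ell(u,w)$ elements. *)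

theory Defs
  imports "HOL-Library.Poly_Mapping" "HOL-Library.Product_Lexorder" "HOL-Combinatorics.Permutations"
begin

section \<open>Permutations\<close>

text \<open>
  Permutations of \<open>{1, 2, 3, \<dots>}\<close> are represented as functions on \<^typ>\<open>nat\<close> that fix \<open>0\<close>; the
  product \<open>u v\<close> is \<^term>\<open>u \<circ> v\<close>.  For a list of indices \<open>[i\<^sub>1, \<dots>, i\<^sub>m]\<close> the library function
  \<^const>\<open>apply_adj_transps\<close> gives the product of the simple transpositions \<open>s\<close> with these
  indices, in this order; \<^const>\<open>apply_transps\<close> does the same for a list of pairs \<open>(a, b)\<close>
  and the transpositions \<open>t\<^sub>a\<^sub>b\<close>.
\<close>

definition S_inf :: "(nat \<Rightarrow> nat) set" where
  "S_inf = {u. bij u \<and> u 0 = 0 \<and> finite {i. u i \<noteq> i}}"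

definition S_upto :: "nat \<Rightarrow> (nat \<Rightarrow> nat) set" where
  "S_upto n = {u \<in> S_inf. \<forall>i>n. u i = i}"

definition len :: "(nat \<Rightarrow> nat) \<Rightarrow> nat" where
  "len u = card {(i, j). 1 \<le> i \<and> i < j \<and> u i > u j}"

definition len_diff :: "(nat \<Rightarrow> nat) \<Rightarrow> (nat \<Rightarrow> nat) \<Rightarrow> int" where
  "len_diff u w = int (len w) - int (len u)"

definition reduced_word :: "(nat \<Rightarrow> nat) \<Rightarrow> nat list \<Rightarrow> bool" where
  "reduced_word u ks \<longleftrightarrow> (\<forall>i\<in>set ks. 1 \<le> i) \<and> apply_adj_transps ks = u \<and> length ks = len u"

definition w0 :: "nat \<Rightarrow> nat \<Rightarrow> nat" where
  "w0 n = (\<lambda>i. if 1 \<le> i \<and> i \<le> n + 1 then n + 2 - i else i)"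


section \<open>The polynomial ring\<close>

text \<open>
  The variables are indexed by positive integers; the three variables with index \<open>0\<close> do not
  occur in any of the polynomials below.
\<close>

datatype var = VX nat | VY nat | VZ nat

text \<open>
  Some linear order on the variables is needed for the library to recognise the polynomial
  ring as an integral domain; which one is irrelevant.
\<close>

fun var_code :: "var \<Rightarrow> nat \<times> nat" where
  "var_code (VX i) = (0, i)"
| "var_code (VY i) = (1, i)"
| "var_code (VZ i) = (2, i)"

lemma var_code_inject: "var_code v = var_code w \<Longrightarrow> v = w"
  by (cases v; cases w) auto

instantiation var :: linorder
begin

definition less_eq_var :: "var \<Rightarrow> var \<Rightarrow> bool" where
  "less_eq_var v w \<longleftrightarrow> var_code v \<le> var_code w"

definition less_var :: "var \<Rightarrow> var \<Rightarrow> bool" where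
  "less_var v w \<longleftrightarrow> var_code v < var_code w"

instance
  by standard
    (unfold less_eq_var_def less_var_def, use linear in \<open>auto simp: less_le_not_le intro: order_trans var_code_inject\<close>)

end

type_synonym mpoly = "(var \<Rightarrow>\<^sub>0 nat) \<Rightarrow>\<^sub>0 int"

definition Var :: "var \<Rightarrow> mpoly" where
  "Var v = Poly_Mapping.single (Poly_Mapping.single v 1) 1"

definition subst :: "(var \<Rightarrow> mpoly) \<Rightarrow> mpoly \<Rightarrow> mpoly" where
  "subst f P = (\<Sum>m\<in>Poly_Mapping.keys P.
     of_int (Poly_Mapping.lookup P m) * (\<Prod>v\<in>Poly_Mapping.keys m. f v ^ Poly_Mapping.lookup m v))"


section \<open>Double Schubert polynomials\<close>

definition swap_x :: "nat \<Rightarrow> mpoly \<Rightarrow> mpoly" where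
  "swap_x i = subst (\<lambda>v. case v of VX j \<Rightarrow> Var (VX (transpose i (i + 1) j)) | _ \<Rightarrow> Var v)"

definition ddiff :: "nat \<Rightarrow> mpoly \<Rightarrow> mpoly" where
  "ddiff i P = (THE Q. (Var (VX i) - Var (VX (i + 1))) * Q = P - swap_x i P)"

definition ddiff_perm :: "(nat \<Rightarrow> nat) \<Rightarrow> mpoly \<Rightarrow> mpoly" where
  "ddiff_perm u P = foldr ddiff (SOME ks. reduced_word u ks) P"

definition schubert_w0 :: "nat \<Rightarrow> mpoly" where
  "schubert_w0 n = (\<Prod>(i, j)\<in>{(i, j). 1 \<le> i \<and> 1 \<le> j \<and> i + j \<le> n + 1}. Var (VX i) - Var (VY j))"

definition schubert_at :: "nat \<Rightarrow> (nat \<Rightarrow> nat) \<Rightarrow> mpoly" where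
  "schubert_at n u = ddiff_perm (inv u \<circ> w0 n) (schubert_w0 n)"

definition schubert :: "(nat \<Rightarrow> nat) \<Rightarrow> mpoly" where
  "schubert u = schubert_at (SOME n. u \<in> S_upto (n + 1)) u"

definition schubert_xz :: "(nat \<Rightarrow> nat) \<Rightarrow> mpoly" where
  "schubert_xz u = subst (\<lambda>v. case v of VY j \<Rightarrow> Var (VZ j) | _ \<Rightarrow> Var v) (schubert u)"


section \<open>Factorial elementary symmetric polynomials\<close>

definition cyc :: "nat \<Rightarrow> nat \<Rightarrow> nat \<Rightarrow> nat" where
  "cyc p k = apply_adj_transps [k + 1 - p..<k + 1]"

definition fact_elem :: "int \<Rightarrow> nat \<Rightarrow> mpoly" where
  "fact_elem p k = (if 0 \<le> p \<and> p \<le> int k then schubert_xz (cyc (nat p) k) else 0)"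

text \<open>
  \<open>fact_elem_y q m A\<close> is \<open>E\<^bsub>q,m\<^esub>(y\<^sub>A; z)\<close>.  It is only meaningful when \<open>A\<close> is a finite set of
  \<open>m\<close> positive integers.
\<close>

definition fact_elem_y :: "int \<Rightarrow> nat \<Rightarrow> nat set \<Rightarrow> mpoly" where
  "fact_elem_y q m A =
     subst (\<lambda>v. case v of
                  VX i \<Rightarrow> if 1 \<le> i \<and> i \<le> m then Var (VY (sorted_list_of_set A ! (i - 1))) else Var v
                | _ \<Rightarrow> Var v)
       (fact_elem q m)"


section \<open>The relation indexing the Pieri formula\<close>

definition pieri_rel :: "nat \<Rightarrow> (nat \<Rightarrow> nat) \<Rightarrow> (nat \<Rightarrow> nat) \<Rightarrow> bool" where
  "pieri_rel k u u' \<longleftrightarrow>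
     (\<exists>ts. length ts \<le> k \<and>
           (\<forall>(a, b)\<in>set ts. 1 \<le> a \<and> a \<le> k \<and> k < b) \<and>
           distinct (map fst ts) \<and>
           (\<forall>i\<in>{1..length ts}. len (u \<circ> apply_transps (take i ts)) = len u + i) \<and>
           u' = u \<circ> apply_transps ts)"

definition P_set :: "nat \<Rightarrow> (nat \<Rightarrow> nat) \<Rightarrow> (nat \<Rightarrow> nat) \<Rightarrow> nat set" where
  "P_set k u w = {u i | i. 1 \<le> i \<and> i \<le> k \<and> u i = w i}"


section \<open>Well-definedness\<close>

text \<open>The quotient defining \<^const>\<open>ddiff\<close> exists and is unique.\<close>

lemma Var_eq_iff: "Var v = Var w \<longleftrightarrow> v = w"
  by (auto simp: Var_def dest!: arg_cong[where f = Poly_Mapping.keys])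

lemma sum_monomials:
  "(\<Sum>x\<in>Poly_Mapping.keys f. Poly_Mapping.single x (Poly_Mapping.lookup f x)) = f"
proof (rule poly_mapping_eqI)
  fix x
  show "Poly_Mapping.lookup (\<Sum>x\<in>Poly_Mapping.keys f. Poly_Mapping.single x (Poly_Mapping.lookup f x)) x
          = Poly_Mapping.lookup f x"
    by (simp add: lookup_sum lookup_single when_def in_keys_iff)
qed

lemma monom_eq_prod: "Poly_Mapping.single m (1::int) = (\<Prod>v\<in>Poly_Mapping.keys m. Var v ^ Poly_Mapping.lookup m v)"
proof -
  have pow: "Var v ^ n = Poly_Mapping.single (Poly_Mapping.single v n) 1" for v n
    by (induction n) (simp_all add: Var_def mult_single flip: single_add)
  have "(\<Prod>v\<in>A. Var v ^ Poly_Mapping.lookup m v) = Poly_Mapping.single (\<Sum>v\<in>A. Poly_Mapping.single v (Poly_Mapping.lookup m v)) 1"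
    if "finite A" for A
    using that by (induction A rule: finite_induct) (simp_all add: pow mult_single)
  moreover have "(\<Sum>v\<in>Poly_Mapping.keys m. Poly_Mapping.single v (Poly_Mapping.lookup m v)) = m"
    by (rule sum_monomials)
  ultimately show ?thesis
    by simp
qed

lemma subst_Var: "subst Var P = P"
proof -
  have "subst Var P = (\<Sum>m\<in>Poly_Mapping.keys P. Poly_Mapping.single m (Poly_Mapping.lookup P m))"
    unfolding subst_def
  proof (rule sum.cong)
    fix m
    show "of_int (Poly_Mapping.lookup P m) * (\<Prod>v\<in>Poly_Mapping.keys m. Var v ^ Poly_Mapping.lookup m v) = Poly_Mapping.single m (Poly_Mapping.lookup P m)"
      by (simp flip: monom_eq_prod single_of_int add: mult_single)
  qed simp
  also have "\<dots> = P"
    by (rule sum_monomials)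
  finally show ?thesis .
qed

lemma dvd_diff_mult:
  fixes a :: "'a::comm_ring_1"
  assumes "d dvd a - a'" "d dvd b - b'"
  shows "d dvd a * b - a' * b'"
proof -
  have "a * b - a' * b' = (a - a') * b + a' * (b - b')"
    by (simp add: algebra_simps)
  then show ?thesis
    using assms by simp
qed

lemma dvd_diff_subst:
  assumes "\<And>v. d dvd f v - g v"
  shows "d dvd subst f P - subst g P"
proof -
  have pow: "d dvd f v ^ n - g v ^ n" for v n
    by (induction n) (auto intro: dvd_diff_mult assms)
  have "d dvd (\<Prod>v\<in>A. f v ^ Poly_Mapping.lookup m v) - (\<Prod>v\<in>A. g v ^ Poly_Mapping.lookup m v)" if "finite A" for A m
    using that by (induction A rule: finite_induct) (auto intro: dvd_diff_mult pow)
  then have "d dvd (\<Sum>m\<in>Poly_Mapping.keys P. of_int (Poly_Mapping.lookup P m) * (\<Prod>v\<in>Poly_Mapping.keys m. f v ^ Poly_Mapping.lookup m v)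
                      - of_int (Poly_Mapping.lookup P m) * (\<Prod>v\<in>Poly_Mapping.keys m. g v ^ Poly_Mapping.lookup m v))"
    by (intro dvd_sum dvd_diff_mult) auto
  then show ?thesis
    by (simp add: subst_def sum_subtractf)
qed

lemma ddiff_exists_unique:
  "\<exists>!Q. (Var (VX i) - Var (VX (i + 1))) * Q = P - swap_x i P"
proof -
  let ?d = "Var (VX i) - Var (VX (i + 1))"
  have neg: "?d dvd Var (VX (i + 1)) - Var (VX i)"
    by (metis dvd_minus_iff dvd_refl minus_diff_eq)
  have "?d dvd subst Var P - swap_x i P"
    unfolding swap_x_def
  proof (rule dvd_diff_subst)
    fix v
    show "?d dvd Var v - (case v of VX j \<Rightarrow> Var (VX (transpose i (i + 1) j)) | _ \<Rightarrow> Var v)"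
      using neg by (cases v) (auto simp: transpose_def)
  qed
  then obtain Q where "P - swap_x i P = ?d * Q"
    by (auto simp: subst_Var)
  moreover have "?d \<noteq> 0"
    by (simp add: Var_eq_iff)
  ultimately show ?thesis
    by (metis mult_cancel_left)
qed

text \<open>The sum in the Pieri formula is finite.\<close>

lemma S_inf_permutes:
  assumes "u \<in> S_inf"
  obtains N where "u permutes {1..N}"
proof -
  have fin: "finite {i. u i \<noteq> i}" and "bij u" and "u 0 = 0"
    using assms by (auto simp: S_inf_def)
  obtain N where N: "\<And>i. u i \<noteq> i \<Longrightarrow> i \<le> N"
    using fin by (metis (mono_tags, lifting) finite_nat_set_iff_bounded_le mem_Collect_eq)
  have "u x = x" if "x \<notin> {1..N}" for x
    using that N[of x] \<open>u 0 = 0\<close> by (cases "x = 0") auto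
  then have "u permutes {1..N}"
    using \<open>bij u\<close> by (simp add: permutes_def bij_iff)
  then show ?thesis ..
qed

lemma finite_inversions:
  assumes "v permutes {1..N}"
  shows "finite {(i::nat, j). 1 \<le> i \<and> i < j \<and> v i > v j}"
proof -
  have "i < j \<Longrightarrow> v i > v j \<Longrightarrow> j \<le> N" for i j
  proof (rule ccontr)
    assume *: "i < j" "v i > v j" "\<not> j \<le> N"
    then have "v j = j"
      using assms by (auto simp: permutes_def)
    then show False
      using * permutes_in_image[OF assms, of i] permutes_not_in[OF assms, of i]
      by (cases "i \<in> {1..N}") auto
  qed
  then have "{(i::nat, j). 1 \<le> i \<and> i < j \<and> v i > v j} \<subseteq> {1..N} \<times> {1..N}"
    by (auto dest: less_imp_le order_less_le_trans) 
       (meson less_imp_le less_le_trans)+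
  then show ?thesis
    by (rule finite_subset) simp
qed

lemma transpose_bound:
  assumes v: "v permutes {1..M}" and ab: "1 \<le> a" "a \<le> k" "k < b"
    and len: "len (v \<circ> transpose a b) \<le> L" and M: "k + L \<le> M"
  shows "v \<circ> transpose a b permutes {1..M}"
proof -
  have "b \<le> M"
  proof (rule ccontr)
    assume "\<not> b \<le> M"
    let ?w = "v \<circ> transpose a b"
    have vb: "v permutes {1..b}"
      using v \<open>\<not> b \<le> M\<close> by (auto intro: permutes_subset)
    have w: "?w permutes {1..b}"
      using vb ab by (intro permutes_compose permutes_swap_id) auto
    have wa: "?w a = b"
      using permutes_not_in[OF v, of b] \<open>\<not> b \<le> M\<close> by simp
    have "Pair a ` {a<..b} \<subseteq> {(i, j). 1 \<le> i \<and> i < j \<and> ?w i > ?w j}"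
    proof clarify
      fix j assume j: "j \<in> {a<..b}"
      then have "?w j \<in> {1..b}"
        using permutes_in_image[OF w, of j] ab by auto
      moreover have "?w j \<noteq> ?w a"
        using j injD[OF permutes_inj[OF w], of j a] by force
      ultimately show "1 \<le> a \<and> a < j \<and> ?w a > ?w j"
        using j ab wa by auto
    qed
    then have "card (Pair a ` {a<..b}) \<le> len ?w"
      unfolding len_def by (rule card_mono[OF finite_inversions[OF w]])
    moreover have "card (Pair a ` {a<..b}) = b - a"
      by (subst card_image) (auto simp: inj_on_def)
    ultimately show False
      using len ab M \<open>\<not> b \<le> M\<close> by linarith
  qed
  then show ?thesis
    using v ab by (intro permutes_compose permutes_swap_id) auto
qed

lemma finite_pieri_rel:
  assumes "u \<in> S_inf"
  shows "finite {w. pieri_rel k u w}"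
proof -
  obtain N where N: "u permutes {1..N}"
    using S_inf_permutes[OF assms] by blast
  define M where "M = max N (k + (len u + k))"
  have "w permutes {1..M}" if "pieri_rel k u w" for w
  proof -
    from that obtain ts where ts: "length ts \<le> k"
      "\<And>a b. (a, b) \<in> set ts \<Longrightarrow> 1 \<le> a \<and> a \<le> k \<and> k < b"
      "\<And>i. i \<in> {1..length ts} \<Longrightarrow> len (u \<circ> apply_transps (take i ts)) = len u + i"
      "w = u \<circ> apply_transps ts"
      unfolding pieri_rel_def by blast
    have "u \<circ> apply_transps (take i ts) permutes {1..M}" if "i \<le> length ts" for i
      using that
    proof (induction i)
      case 0
      then show ?case
        using permutes_subset[OF N, of "{1..M}"] by (simp add: M_def)
    next
      case (Suc i)
      obtain a b where ab: "ts ! i = (a, b)"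
        by fastforce
      then have mem: "(a, b) \<in> set ts"
        using Suc.prems by (metis Suc_le_lessD nth_mem)
      have eq: "u \<circ> apply_transps (take (Suc i) ts) = (u \<circ> apply_transps (take i ts)) \<circ> transpose a b"
        using Suc.prems ab by (simp add: take_Suc_conv_app_nth comp_assoc)
      have "len ((u \<circ> apply_transps (take i ts)) \<circ> transpose a b) \<le> len u + k"
        using ts(1) ts(3)[of "Suc i"] Suc.prems unfolding eq by auto
      then show ?case
        unfolding eq using Suc.IH Suc.prems ts(2)[OF mem]
        by (intro transpose_bound[where k = k and L = "len u + k"]) (simp_all add: M_def del: o_apply)
    qed
    from this[of "length ts"] show ?thesis
      by (simp add: ts(4))
  qed
  then have "{w. pieri_rel k u w} \<subseteq> {w. w permutes {1..M}}"
    by blast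
  then show ?thesis
    by (rule finite_subset) (simp add: finite_permutations)
qed

end

theory Submission
  imports Defs
begin

text \<open>
  The case \<open>p = k\<close> is proved first, where \<open>E\<^sub>k\<^sub>,\<^sub>k(x;z) = \<Prod>\<^sub>i\<^sub>\<le>\<^sub>k (x\<^sub>i - z\<^sub>1)\<close> and the coefficient of \<open>\<SS>\<^sub>w\<close> is the
  product of the \<open>y\<^sub>c - z\<^sub>1\<close> over \<open>c \<in> P\<^sub>k(u,w)\<close>; divided differences in the \<open>z\<close> variables,
  which send \<open>E\<^sub>p\<^sub>+\<^sub>1\<^sub>,\<^sub>k\<close> to \<open>- E\<^sub>p\<^sub>,\<^sub>k\<close> and act on both sides with the same index \<open>k - p\<close>, then give all
  smaller \<open>p\<close>.

  The case \<open>p = k\<close> goes by downward induction on the length of \<open>u\<close>, starting from the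
  longest element, where it amounts to expanding
  \<open>\<Prod>\<^sub>i ((x\<^sub>i - y\<^sub>n\<^sub>+\<^sub>2\<^sub>-\<^sub>i) + (y\<^sub>n\<^sub>+\<^sub>2\<^sub>-\<^sub>i - z\<^sub>1))\<close>.  An ascent of \<open>u\<close> at a position \<open>i \<noteq> k\<close> is treated with the
  divided difference in \<open>x\<^sub>i, x\<^sub>i\<^sub>+\<^sub>1\<close>, for which the factor \<open>\<Prod> (x\<^sub>i - z\<^sub>1)\<close> is a constant.  If the ascent is at \<open>k\<close>,
  some value \<open>i\<close> sits at a position \<open>\<le> k\<close> and \<open>i + 1\<close> at a position \<open>> k\<close>; now the
  divided difference in \<open>y\<^sub>i, y\<^sub>i\<^sub>+\<^sub>1\<close> passes from \<open>s\<^sub>i u\<close> to \<open>u\<close>.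
\<close>

section \<open>Substitutions\<close>

text \<open>The product of the factors x_i - z_1 over i \<le> k is symmetric in x_j and x_{j+1}
  except for j = k, and this one exception forces the passage to the y variables. There the product
  is a constant, but the coefficients are not: the Leibniz rule gives two terms for each w, and
  these match the two ways in which chains from u and from s_i u are related. No Schubert polynomial
  contains a z variable, so divided differences in z act on the coefficients alone; all terms take
  the same index because (k - l) - (p - l) = k - p for every l. \<open>ddiff_perm\<close> and
  \<open>schubert\<close> are defined by choices, so independence of the reduced word and of n has
  to be established. The latter rests on the explicit family \<open>w0_plus n A\<close>, whose
  members for A inside {1..k} are also the indices in the formula for the longest element.\<close>

lemma subst_superset:
  assumes "finite S" "Poly_Mapping.keys P \<subseteq> S"
  shows "subst f P = (\<Sum>m\<in>S. of_int (Poly_Mapping.lookup P m) *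
           (\<Prod>v\<in>Poly_Mapping.keys m. f v ^ Poly_Mapping.lookup m v))"
  unfolding subst_def using assms
  by (intro sum.mono_neutral_left) (auto simp: in_keys_iff)

lemma subst_add [simp]: "subst f (P + Q) = subst f P + subst f Q"
proof -
  let ?S = "Poly_Mapping.keys P \<union> Poly_Mapping.keys Q"
  have "Poly_Mapping.keys (P + Q) \<subseteq> ?S"
    by (rule keys_add)
  then show ?thesis
    by (simp add: subst_superset[of ?S] lookup_add algebra_simps sum.distrib)
qed

lemma subst_zero [simp]: "subst f 0 = 0"
  by (simp add: subst_def)

lemma subst_sum [simp]: "subst f (\<Sum>i\<in>A. g i) = (\<Sum>i\<in>A. subst f (g i))"
  by (induction A rule: infinite_finite_induct) auto

lemma subst_uminus [simp]: "subst f (- P) = - subst f P"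
  by (metis add.inverse_unique add.right_inverse subst_add subst_zero)

lemma subst_diff [simp]: "subst f (P - Q) = subst f P - subst f Q"
  by (metis diff_conv_add_uminus subst_add subst_uminus)

lemma subst_single:
  "subst f (Poly_Mapping.single m c) =
     of_int c * (\<Prod>v\<in>Poly_Mapping.keys m. f v ^ Poly_Mapping.lookup m v)"
  by (subst subst_superset[of "{m}"]) auto

lemma prod_keys_add:
  fixes f :: "var \<Rightarrow> mpoly"
  shows "(\<Prod>v\<in>Poly_Mapping.keys (m + n). f v ^ Poly_Mapping.lookup (m + n) v) =
    (\<Prod>v\<in>Poly_Mapping.keys m. f v ^ Poly_Mapping.lookup m v) *
    (\<Prod>v\<in>Poly_Mapping.keys n. f v ^ Poly_Mapping.lookup n v)"
proof -
  let ?S = "Poly_Mapping.keys m \<union> Poly_Mapping.keys n"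
  have ext: "(\<Prod>v\<in>Poly_Mapping.keys k. f v ^ Poly_Mapping.lookup k v) =
      (\<Prod>v\<in>?S. f v ^ Poly_Mapping.lookup k v)" if "Poly_Mapping.keys k \<subseteq> ?S" for k
    using that by (intro prod.mono_neutral_left) (auto simp: in_keys_iff)
  have "(\<Prod>v\<in>Poly_Mapping.keys (m + n). f v ^ Poly_Mapping.lookup (m + n) v) =
      (\<Prod>v\<in>?S. f v ^ Poly_Mapping.lookup (m + n) v)"
    by (rule ext[OF keys_add])
  then show ?thesis
    by (simp add: ext[of m] ext[of n] lookup_add power_add prod.distrib)
qed

lemma subst_mult [simp]: "subst f (P * Q) = subst f P * subst f Q"
proof -
  have single: "subst f (Poly_Mapping.single m a * Poly_Mapping.single n b) =
      subst f (Poly_Mapping.single m a) * subst f (Poly_Mapping.single n b)" for m n a b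
    by (simp add: mult_single subst_single prod_keys_add algebra_simps)
  have "subst f (P * Q) = subst f ((\<Sum>m\<in>Poly_Mapping.keys P. Poly_Mapping.single m (Poly_Mapping.lookup P m)) *
      (\<Sum>n\<in>Poly_Mapping.keys Q. Poly_Mapping.single n (Poly_Mapping.lookup Q n)))"
    by (simp only: sum_monomials)
  also have "\<dots> = subst f (\<Sum>m\<in>Poly_Mapping.keys P. Poly_Mapping.single m (Poly_Mapping.lookup P m)) *
      subst f (\<Sum>n\<in>Poly_Mapping.keys Q. Poly_Mapping.single n (Poly_Mapping.lookup Q n))"
    by (simp add: sum_product single)
  finally show ?thesis
    by (simp only: sum_monomials)
qed

lemma subst_one [simp]: "subst f 1 = 1"
  using subst_single[of f 0 1] by simp

lemma subst_of_int [simp]: "subst f (of_int c) = of_int c"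
proof -
  have "Poly_Mapping.single 0 c = (of_int c :: mpoly)"
    by (metis of_int_eq_id id_apply single_of_int)
  then show ?thesis
    using subst_single[of f 0 c] by simp
qed

lemma subst_Var_apply [simp]: "subst f (Var v) = f v"
  unfolding Var_def by (simp add: subst_single)

lemma subst_power [simp]: "subst f (P ^ n) = subst f P ^ n"
  by (induction n) auto

lemma subst_prod [simp]: "subst f (\<Prod>i\<in>A. g i) = (\<Prod>i\<in>A. subst f (g i))"
  by (induction A rule: infinite_finite_induct) auto

lemma subst_subst: "subst f (subst g P) = subst (\<lambda>v. subst f (g v)) P"
  by (simp add: subst_def[of g] subst_def[of "\<lambda>v. subst f (g v)"])

section \<open>Divided differences\<close>

definition swap_var :: "var \<Rightarrow> var \<Rightarrow> mpoly \<Rightarrow> mpoly" where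
  "swap_var a b = subst (\<lambda>v. Var (transpose a b v))"

text \<open>
  Divided differences with respect to an arbitrary pair of variables: besides the operators in the
  \<open>x\<close> variables, the proof needs those in the \<open>y\<close> and \<open>z\<close> variables.  The value for \<open>a = b\<close> is junk.
\<close>

definition div_diff :: "var \<Rightarrow> var \<Rightarrow> mpoly \<Rightarrow> mpoly" where
  "div_diff a b P = (THE Q. (Var a - Var b) * Q = P - swap_var a b P)"

lemma swap_var_simps [simp]:
  "swap_var a b (P + Q) = swap_var a b P + swap_var a b Q"
  "swap_var a b (P - Q) = swap_var a b P - swap_var a b Q"
  "swap_var a b (P * Q) = swap_var a b P * swap_var a b Q"
  "swap_var a b (- P) = - swap_var a b P"
  "swap_var a b 0 = 0"
  "swap_var a b 1 = 1"
  "swap_var a b (Var v) = Var (transpose a b v)"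
  by (simp_all add: swap_var_def)

lemma swap_var_prod: "swap_var a b (\<Prod>i\<in>A. g i) = (\<Prod>i\<in>A. swap_var a b (g i))"
  by (simp add: swap_var_def)

lemma swap_var_involutory [simp]: "swap_var a b (swap_var a b P) = P"
  by (simp add: swap_var_def subst_subst subst_Var)

lemma swap_var_braid:
  assumes "a \<noteq> b" "b \<noteq> c" "a \<noteq> c"
  shows "swap_var a b (swap_var b c (swap_var a b P)) = swap_var b c (swap_var a b (swap_var b c P))"
proof -
  have "transpose a b (transpose b c (transpose a b v)) = transpose b c (transpose a b (transpose b c v))" for v
    using assms by (auto simp: transpose_def)
  then show ?thesis
    by (simp add: swap_var_def subst_subst)
qed

lemma Var_diff_nonzero: "a \<noteq> b \<Longrightarrow> Var a - Var b \<noteq> 0"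
  by (simp add: Var_eq_iff)

text \<open>Modulo \<open>Var a - Var b\<close> the two variables coincide, so the identity
  substitution and the exchange agree; uniqueness is cancellation in a domain.\<close>

lemma div_diff_ex1:
  assumes "a \<noteq> b"
  shows "\<exists>!Q. (Var a - Var b) * Q = P - swap_var a b P"
proof -
  have "Var a - Var b dvd Var b - Var a"
    by (metis dvd_minus_iff dvd_refl minus_diff_eq)
  then have "Var a - Var b dvd Var v - Var (transpose a b v)" for v
    unfolding transpose_def by simp
  then have "Var a - Var b dvd P - swap_var a b P"
    using dvd_diff_subst[of "Var a - Var b" Var "\<lambda>v. Var (transpose a b v)" P]
    by (simp add: swap_var_def subst_Var)
  then obtain Q where Q: "P - swap_var a b P = (Var a - Var b) * Q"
    by (rule dvdE)
  show ?thesis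
    using Var_diff_nonzero[OF assms] unfolding Q by (intro ex1I[of _ Q]) simp_all
qed

lemma div_diff_mult: "a \<noteq> b \<Longrightarrow> (Var a - Var b) * div_diff a b P = P - swap_var a b P"
  unfolding div_diff_def by (rule theI'[OF div_diff_ex1])

lemma div_diff_eqI:
  assumes "a \<noteq> b" "(Var a - Var b) * Q = P - swap_var a b P"
  shows "div_diff a b P = Q"
  using assms div_diff_ex1 div_diff_mult by blast

lemma div_diff_0 [simp]: "a \<noteq> b \<Longrightarrow> div_diff a b 0 = 0"
  by (rule div_diff_eqI) auto

lemma div_diff_add: "a \<noteq> b \<Longrightarrow> div_diff a b (P + Q) = div_diff a b P + div_diff a b Q"
  by (rule div_diff_eqI) (auto simp: distrib_left div_diff_mult)

lemma div_diff_uminus: "a \<noteq> b \<Longrightarrow> div_diff a b (- P) = - div_diff a b P"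
  by (rule div_diff_eqI) (auto simp: div_diff_mult)

lemma div_diff_diff: "a \<noteq> b \<Longrightarrow> div_diff a b (P - Q) = div_diff a b P - div_diff a b Q"
  by (rule div_diff_eqI) (auto simp: right_diff_distrib div_diff_mult)

lemma div_diff_sum: "a \<noteq> b \<Longrightarrow> div_diff a b (\<Sum>i\<in>A. g i) = (\<Sum>i\<in>A. div_diff a b (g i))"
  by (induction A rule: infinite_finite_induct) (auto simp: div_diff_add)

text \<open>The exchange falls on the first factor. With a coefficient as \<open>P\<close> and a
  Schubert polynomial as \<open>Q\<close>, the two summands become the two kinds of terms in
  \<open>top_pieri_adj_comp\<close>.\<close>

lemma div_diff_Leibniz:
  assumes "a \<noteq> b"
  shows "div_diff a b (P * Q) = div_diff a b P * Q + swap_var a b P * div_diff a b Q"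
proof (rule div_diff_eqI[OF assms])
  have "(Var a - Var b) * (div_diff a b P * Q + swap_var a b P * div_diff a b Q) =
      ((Var a - Var b) * div_diff a b P) * Q + swap_var a b P * ((Var a - Var b) * div_diff a b Q)"
    by (simp add: algebra_simps)
  also have "\<dots> = P * Q - swap_var a b (P * Q)"
    unfolding div_diff_mult[OF assms] by (simp add: algebra_simps)
  finally show "(Var a - Var b) * (div_diff a b P * Q + swap_var a b P * div_diff a b Q) =
      P * Q - swap_var a b (P * Q)" .
qed

lemma div_diff_symmetric:
  assumes "a \<noteq> b" "swap_var a b P = P"
  shows "div_diff a b P = 0"
  using assms by (intro div_diff_eqI) auto

lemma div_diff_mult_symmetric:
  assumes "a \<noteq> b" "swap_var a b P = P"
  shows "div_diff a b (P * Q) = P * div_diff a b Q"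
  using assms by (simp add: div_diff_Leibniz div_diff_symmetric)

lemma div_diff_Var_mult:
  assumes "a \<noteq> b" "c \<noteq> a" "c \<noteq> b" "swap_var a b P = P"
  shows "div_diff a b ((Var a - Var c) * P) = P"
  using assms by (intro div_diff_eqI) (auto simp: algebra_simps transpose_def)

text \<open>The sign in this variant is the source of the minus signs in all divided differences in
  the y and z variables below.\<close>

lemma div_diff_Var_mult':
  assumes "a \<noteq> b" "c \<noteq> a" "c \<noteq> b" "swap_var a b P = P"
  shows "div_diff a b ((Var c - Var a) * P) = - P"
  using assms by (intro div_diff_eqI) (auto simp: algebra_simps transpose_def)

lemma swap_var_div_diff [simp]:
  assumes "a \<noteq> b"
  shows "swap_var a b (div_diff a b P) = div_diff a b P"
proof -
  have "swap_var a b ((Var a - Var b) * div_diff a b P) = swap_var a b P - P"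
    by (simp only: div_diff_mult[OF assms] swap_var_simps swap_var_involutory)
  then have "(Var a - Var b) * swap_var a b (div_diff a b P) = P - swap_var a b P"
    by (simp add: algebra_simps)
  then show ?thesis
    by (rule div_diff_eqI[OF assms, symmetric])
qed

lemma div_diff_div_diff [simp]: "a \<noteq> b \<Longrightarrow> div_diff a b (div_diff a b P) = 0"
  by (rule div_diff_symmetric) auto

text \<open>The hypotheses make \<open>subst f\<close> carry the exchange of \<open>a\<close> and
  \<open>b\<close> to that of \<open>a'\<close> and \<open>b'\<close>, hence quotient to quotient.
  Variables other than \<open>a\<close> and \<open>b\<close> may go to any symmetric polynomial, in
  particular to 0.\<close>

lemma div_diff_subst:
  assumes "a \<noteq> b" "a' \<noteq> b'" "f a = Var a'" "f b = Var b'"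
    and "\<And>v. v \<noteq> a \<Longrightarrow> v \<noteq> b \<Longrightarrow> swap_var a' b' (f v) = f v"
  shows "div_diff a' b' (subst f P) = subst f (div_diff a b P)"
proof (rule div_diff_eqI[OF \<open>a' \<noteq> b'\<close>])
  have "subst f (Var (transpose a b v)) = swap_var a' b' (f v)" for v
    using assms by (cases "v = a"; cases "v = b") auto
  then have "subst f (swap_var a b P) = swap_var a' b' (subst f P)"
    by (simp add: swap_var_def subst_subst)
  moreover have "subst f ((Var a - Var b) * div_diff a b P) = subst f (P - swap_var a b P)"
    using div_diff_mult[OF \<open>a \<noteq> b\<close>] by simp
  ultimately show "(Var a' - Var b') * subst f (div_diff a b P) = subst f P - swap_var a' b' (subst f P)"
    using assms by simp
qed

lemma div_diff_swap_var:
  assumes "a \<noteq> b" "c \<noteq> a" "c \<noteq> b" "d \<noteq> a" "d \<noteq> b"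
  shows "div_diff a b (swap_var c d P) = swap_var c d (div_diff a b P)"
  unfolding swap_var_def[of c d] by (rule div_diff_subst) (use assms in \<open>auto simp: transpose_def\<close>)

lemma div_diff_commute:
  assumes "a \<noteq> b" "c \<noteq> d" "c \<noteq> a" "c \<noteq> b" "d \<noteq> a" "d \<noteq> b"
  shows "div_diff a b (div_diff c d P) = div_diff c d (div_diff a b P)"
proof (rule div_diff_eqI[OF \<open>c \<noteq> d\<close>, symmetric])
  have "div_diff a b ((Var c - Var d) * div_diff c d P) = (Var c - Var d) * div_diff a b (div_diff c d P)"
    using assms by (intro div_diff_mult_symmetric) auto
  then show "(Var c - Var d) * div_diff a b (div_diff c d P) = div_diff a b P - swap_var c d (div_diff a b P)"
    using assms by (simp add: div_diff_mult div_diff_diff div_diff_swap_var)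
qed

text \<open>Both sides equal the antisymmetrisation of \<open>P\<close> divided by the Vandermonde product.\<close>

lemma div_diff_braid_aux:
  assumes "a \<noteq> b" "b \<noteq> c" "a \<noteq> c"
  shows "(Var a - Var b) * (Var a - Var c) * (Var b - Var c) * div_diff a b (div_diff b c (div_diff a b P)) =
    P - swap_var a b P - swap_var b c P + swap_var b c (swap_var a b P) + swap_var a b (swap_var b c P)
      - swap_var a b (swap_var b c (swap_var a b P))"
proof -
  let ?Y = "div_diff a b P" and ?X = "div_diff b c (div_diff a b P)"
  have Y: "(Var a - Var b) * ?Y = P - swap_var a b P"
    by (rule div_diff_mult) fact
  have X: "(Var b - Var c) * ?X = ?Y - swap_var b c ?Y"
    by (rule div_diff_mult) fact
  have sX: "(Var a - Var c) * swap_var a b ?X = ?Y - swap_var a b (swap_var b c ?Y)"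
    using arg_cong[OF X, of "swap_var a b"] assms by (simp add: transpose_def)
  have tY: "(Var a - Var c) * swap_var b c ?Y = swap_var b c P - swap_var b c (swap_var a b P)"
    using arg_cong[OF Y, of "swap_var b c"] assms by (simp add: transpose_def)
  have stY: "(Var b - Var c) * swap_var a b (swap_var b c ?Y) =
      swap_var a b (swap_var b c P) - swap_var a b (swap_var b c (swap_var a b P))"
    using arg_cong[OF tY, of "swap_var a b"] assms by (simp add: transpose_def)
  have "(Var a - Var b) * (Var a - Var c) * (Var b - Var c) * div_diff a b ?X =
      (Var a - Var c) * (Var b - Var c) * ((Var a - Var b) * div_diff a b ?X)"
    by (simp add: algebra_simps)
  also have "\<dots> = (Var a - Var c) * ((Var b - Var c) * ?X) - (Var b - Var c) * ((Var a - Var c) * swap_var a b ?X)"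
    unfolding div_diff_mult[OF assms(1)] by (simp add: algebra_simps)
  also have "\<dots> = (Var a - Var b) * ?Y - (Var a - Var c) * swap_var b c ?Y
      + (Var b - Var c) * swap_var a b (swap_var b c ?Y)"
    unfolding X sX by (simp add: algebra_simps)
  finally show ?thesis
    unfolding Y tY stY by (simp add: algebra_simps)
qed

lemma swap_var_sym: "swap_var a b = swap_var b a"
  by (simp add: swap_var_def transpose_commute)

lemma div_diff_sym:
  assumes "a \<noteq> b"
  shows "div_diff b a P = - div_diff a b P"
proof (rule div_diff_eqI)
  show "(Var b - Var a) * - div_diff a b P = P - swap_var b a P"
    using div_diff_mult[OF assms, of P] by (simp add: swap_var_sym[of b a] algebra_simps)
qed (use assms in auto)

lemma div_diff_braid:
  assumes "a \<noteq> b" "b \<noteq> c" "a \<noteq> c"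
  shows "div_diff a b (div_diff b c (div_diff a b P)) = div_diff b c (div_diff a b (div_diff b c P))"
proof -
  have ne: "b \<noteq> a" "c \<noteq> b" "c \<noteq> a"
    using assms by auto
  let ?d = "(Var a - Var b) * (Var a - Var c) * (Var b - Var c)"
  \<comment> \<open>Reversing all three pairs turns the right-hand word into the left-hand one for
    the variables c, b, a. This costs three signs, which the reversed Vandermonde product
    compensates.\<close>
  have "div_diff b c (div_diff a b (div_diff b c P)) = - div_diff c b (div_diff b a (div_diff c b P))"
    using assms ne
    by (simp add: div_diff_sym[of b c] div_diff_sym[of a b] div_diff_uminus)
  then have "?d * div_diff b c (div_diff a b (div_diff b c P)) =
      (Var c - Var b) * (Var c - Var a) * (Var b - Var a) * div_diff c b (div_diff b a (div_diff c b P))"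
    by (simp add: algebra_simps)
  also have "\<dots> = P - swap_var b c P - swap_var a b P + swap_var a b (swap_var b c P) + swap_var b c (swap_var a b P)
      - swap_var b c (swap_var a b (swap_var b c P))"
    unfolding div_diff_braid_aux[OF ne(2,1,3)] by (simp add: swap_var_sym[of c b] swap_var_sym[of b a])
  also have "\<dots> = ?d * div_diff a b (div_diff b c (div_diff a b P))"
    unfolding div_diff_braid_aux[OF assms] swap_var_braid[OF assms] by simp
  finally show ?thesis
    using assms by (simp add: Var_eq_iff)
qed

lemma swap_x_eq: "swap_x i = swap_var (VX i) (VX (i + 1))"
  unfolding swap_x_def swap_var_def
  by (intro arg_cong[of _ _ subst]) (auto simp: fun_eq_iff transpose_def split: var.splits)

lemma ddiff_eq: "ddiff i = div_diff (VX i) (VX (i + 1))"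
  by (simp add: fun_eq_iff ddiff_def div_diff_def swap_x_eq)

section \<open>Permutations and length\<close>

lemma S_inf_iff_permutes: "u \<in> S_inf \<longleftrightarrow> (\<exists>N. u permutes {1..N})"
proof
  assume "\<exists>N. u permutes {1..N}"
  then obtain N where N: "u permutes {1..N}" ..
  have "{i. u i \<noteq> i} \<subseteq> {1..N}"
    using permutes_not_in[OF N] by blast
  then show "u \<in> S_inf"
    using permutes_bij[OF N] permutes_not_in[OF N, of 0]
    by (auto simp: S_inf_def intro: finite_subset)
qed (use S_inf_permutes in blast)

lemma S_inf_bij: "u \<in> S_inf \<Longrightarrow> bij u"
  by (simp add: S_inf_def)

lemma S_inf_0: "u \<in> S_inf \<Longrightarrow> u 0 = 0"
  by (simp add: S_inf_def)

lemma S_inf_eq_iff: "u \<in> S_inf \<Longrightarrow> u i = u j \<longleftrightarrow> i = j"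
  using S_inf_bij[of u] by (auto simp: bij_def inj_def)

lemma S_inf_pos: "u \<in> S_inf \<Longrightarrow> 1 \<le> u i \<longleftrightarrow> 1 \<le> i"
  using S_inf_eq_iff[of u i 0] S_inf_0[of u] by (cases "i = 0") auto

lemma S_inf_inv_apply: "u \<in> S_inf \<Longrightarrow> u (inv u i) = i" "u \<in> S_inf \<Longrightarrow> inv u (u i) = i"
  using S_inf_bij[of u] by (simp_all add: bij_is_surj surj_f_inv_f bij_is_inj)

lemma id_in_S_inf [simp]: "id \<in> S_inf"
  by (auto simp: S_inf_def)

lemma comp_in_S_inf [simp]: "u \<in> S_inf \<Longrightarrow> v \<in> S_inf \<Longrightarrow> u \<circ> v \<in> S_inf"
proof -
  assume *: "u \<in> S_inf" "v \<in> S_inf"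
  obtain N M where "u permutes {1..N}" "v permutes {1..M}"
    using * unfolding S_inf_iff_permutes by blast
  then have "u permutes {1..max N M}" "v permutes {1..max N M}"
    by (auto elim!: permutes_subset)
  then have "u \<circ> v permutes {1..max N M}"
    by (intro permutes_compose)
  then show ?thesis
    unfolding S_inf_iff_permutes ..
qed

lemma inv_in_S_inf [simp]: "u \<in> S_inf \<Longrightarrow> inv u \<in> S_inf"
  unfolding S_inf_iff_permutes using permutes_inv by blast

lemma transpose_in_S_inf [simp]: "1 \<le> a \<Longrightarrow> 1 \<le> b \<Longrightarrow> transpose a b \<in> S_inf"
  unfolding S_inf_iff_permutes by (intro exI[of _ "max a b"] permutes_swap_id) auto

lemma transpose_comp_transpose [simp]: "u \<circ> transpose a b \<circ> transpose a b = u"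
  "transpose a b \<circ> (transpose a b \<circ> u) = u"
  by (simp_all add: fun_eq_iff)

lemma comp_transpose_in_S_inf_iff [simp]:
  "1 \<le> a \<Longrightarrow> 1 \<le> b \<Longrightarrow> u \<circ> transpose a b \<in> S_inf \<longleftrightarrow> u \<in> S_inf"
  "1 \<le> a \<Longrightarrow> 1 \<le> b \<Longrightarrow> transpose a b \<circ> u \<in> S_inf \<longleftrightarrow> u \<in> S_inf"
  by (metis comp_in_S_inf transpose_in_S_inf transpose_comp_transpose)+

lemma S_upto_imp_S_inf: "u \<in> S_upto n \<Longrightarrow> u \<in> S_inf"
  by (simp add: S_upto_def)

lemma S_upto_iff_permutes: "u \<in> S_upto n \<longleftrightarrow> u permutes {1..n}"
proof
  assume u: "u \<in> S_upto n"
  then have "u i = i" if "i \<notin> {1..n}" for i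
    using that S_inf_0[OF S_upto_imp_S_inf[OF u]] by (cases "i = 0") (auto simp: S_upto_def)
  then show "u permutes {1..n}"
    using S_inf_bij[OF S_upto_imp_S_inf[OF u]] by (simp add: permutes_def bij_iff)
next
  assume "u permutes {1..n}"
  then show "u \<in> S_upto n"
    using permutes_not_in[of u "{1..n}"] by (auto simp: S_upto_def S_inf_iff_permutes)
qed

lemma S_upto_mono: "u \<in> S_upto n \<Longrightarrow> n \<le> m \<Longrightarrow> u \<in> S_upto m"
  by (simp add: S_upto_def)

lemma S_upto_transpose:
  assumes "u \<in> S_upto n" "a \<in> {1..n}" "b \<in> {1..n}"
  shows "u \<circ> transpose a b \<in> S_upto n" "transpose a b \<circ> u \<in> S_upto n"
  using assms by (simp_all only: S_upto_iff_permutes permutes_compose permutes_swap_id)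

lemma S_inf_S_upto: "u \<in> S_inf \<Longrightarrow> \<exists>N. \<forall>n\<ge>N. u \<in> S_upto n"
  by (metis S_inf_iff_permutes S_upto_iff_permutes S_upto_mono)

section \<open>Inversions, and the change of length under a transposition\<close>

definition inversions :: "(nat \<Rightarrow> nat) \<Rightarrow> (nat \<times> nat) set" where
  "inversions u = {(i, j). 1 \<le> i \<and> i < j \<and> u i > u j}"

lemma len_eq_card_inversions: "len u = card (inversions u)"
  by (simp add: len_def inversions_def)

lemma finite_inversions_S_inf: "u \<in> S_inf \<Longrightarrow> finite (inversions u)"
  unfolding inversions_def S_inf_iff_permutes using finite_inversions by blast

text \<open>A crude bound suffices: it only has to provide a measure for induction downward on the
  length.\<close>

lemma len_S_upto_le:
  assumes "u \<in> S_upto n"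
  shows "len u \<le> n * n"
proof -
  have u: "u permutes {1..n}"
    using assms by (simp add: S_upto_iff_permutes)
  have "j \<le> n" if "i < j" "u j < u i" for i j
  proof (rule ccontr)
    assume "\<not> j \<le> n"
    then have "u j = j"
      using u by (auto simp: permutes_def)
    then show False
      using that \<open>\<not> j \<le> n\<close> permutes_in_image[OF u, of i] permutes_not_in[OF u, of i]
      by (cases "i \<in> {1..n}") auto
  qed
  then have "inversions u \<subseteq> {1..n} \<times> {1..n}"
    by (force simp: inversions_def)
  then have "len u \<le> card ({1..n} \<times> {1..n})"
    unfolding len_eq_card_inversions by (intro card_mono) auto
  then show ?thesis
    by simp
qed

text \<open>Maps inversions of \<open>u\<close> to inversions of \<open>u t\<^sub>a\<^sub>b\<close> if \<open>u(a) < u(b)\<close>.\<close>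

definition move_pair :: "nat \<Rightarrow> nat \<Rightarrow> nat \<times> nat \<Rightarrow> nat \<times> nat" where
  "move_pair a b = (\<lambda>(i, j). if a \<le> i \<and> j \<le> b then (i, j) else (transpose a b i, transpose a b j))"

text \<open>Pairs inside the window from a to b stay, all others are relabelled, and both classes
  are preserved; hence \<open>move_pair\<close> is its own inverse here. The pair (a, b) is missed
  because it is no inversion of \<open>u\<close>.\<close>

lemma move_pair_inversions:
  assumes "a < b" "1 \<le> a" "u a < u b"
  shows "inj_on (move_pair a b) (inversions u)"
    and "move_pair a b ` inversions u \<subseteq> inversions (u \<circ> transpose a b) - {(a, b)}"
proof -
  show "inj_on (move_pair a b) (inversions u)"
    by (rule inj_on_inverseI[of _ "move_pair a b"])
      (use assms in \<open>auto simp: move_pair_def inversions_def transpose_def\<close>)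
  show "move_pair a b ` inversions u \<subseteq> inversions (u \<circ> transpose a b) - {(a, b)}"
  proof (rule image_subsetI)
    fix x assume "x \<in> inversions u"
    then show "move_pair a b x \<in> inversions (u \<circ> transpose a b) - {(a, b)}"
      using assms by (cases x) (auto simp: move_pair_def inversions_def transpose_def split: if_splits)
  qed
qed

lemma len_transpose_less:
  assumes "u \<in> S_inf" "1 \<le> a" "a < b" "u a < u b"
  shows "len u < len (u \<circ> transpose a b)"
proof -
  have fin: "finite (inversions (u \<circ> transpose a b))"
    using assms by (intro finite_inversions_S_inf) simp
  have "card (move_pair a b ` inversions u) = card (inversions u)"
    by (rule card_image[OF move_pair_inversions(1)]) fact+
  then have "card (inversions u) \<le> card (inversions (u \<circ> transpose a b) - {(a, b)})"
    using card_mono[OF _ move_pair_inversions(2)[of a b u]] assms fin by simp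
  moreover have "(a, b) \<in> inversions (u \<circ> transpose a b)"
    using assms by (simp add: inversions_def)
  ultimately show ?thesis
    unfolding len_eq_card_inversions using fin by (meson card_Diff1_less le_less_trans)
qed

lemma len_transpose_greater:
  assumes "u \<in> S_inf" "1 \<le> a" "a < b" "u b < u a"
  shows "len (u \<circ> transpose a b) < len u"
  using len_transpose_less[of "u \<circ> transpose a b" a b] assms by simp

lemma len_transpose_Suc:
  assumes "u \<in> S_inf" "1 \<le> a" "a < b" "u a < u b"
    and "\<And>c. a < c \<Longrightarrow> c < b \<Longrightarrow> \<not> (u a < u c \<and> u c < u b)"
  shows "len (u \<circ> transpose a b) = Suc (len u)"
proof -
  let ?I = "inversions (u \<circ> transpose a b)"
  have between: "u c < u a \<or> u b < u c" if "a < c" "c < b" for c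
    using assms(5)[OF that] S_inf_eq_iff[OF assms(1), of a c] S_inf_eq_iff[OF assms(1), of c b] that
    by linarith
  \<comment> \<open>The preimage is obtained by applying \<open>move_pair\<close> again. Only pairs
    in the window with exactly one end at a or b need the assumption that no value lies in
    between.\<close>
  have "(i, j) \<in> move_pair a b ` inversions u" if "(i, j) \<in> ?I" "(i, j) \<noteq> (a, b)" for i j
  proof (rule image_eqI)
    show "(i, j) = move_pair a b (move_pair a b (i, j))"
      using that assms by (auto simp: move_pair_def inversions_def transpose_def)
    show "move_pair a b (i, j) \<in> inversions u"
    proof (cases "a \<le> i \<and> j \<le> b")
      case True
      then have "i = a \<and> a < j \<and> j < b \<or> j = b \<and> a < i \<and> i < b \<or> a < i \<and> i < j \<and> j < b"
        using that by (auto simp: inversions_def)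
      then show ?thesis
        using True that between[of i] between[of j] assms
        by (auto simp: move_pair_def inversions_def transpose_def)
    qed (use that assms in \<open>auto simp: move_pair_def inversions_def transpose_def split: if_splits\<close>)
  qed
  then have "?I - {(a, b)} \<subseteq> move_pair a b ` inversions u"
    by auto
  then have "?I - {(a, b)} = move_pair a b ` inversions u"
    using move_pair_inversions(2)[of a b u] assms by blast
  then have "card (?I - {(a, b)}) = len u"
    using card_image[OF move_pair_inversions(1)[of a b u]] assms by (simp add: len_eq_card_inversions)
  moreover have "(a, b) \<in> ?I"
    using assms by (simp add: inversions_def)
  moreover have "finite ?I"
    using assms by (intro finite_inversions_S_inf) simp
  ultimately show ?thesis
    using card_Suc_Diff1[of ?I "(a, b)"] by (simp add: len_eq_card_inversions)
qed

text \<open>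
  If \<open>c\<close> lies in between, then \<open>u t\<^sub>a\<^sub>b\<close> is reached from \<open>u\<close> by the three upward exchanges
  \<open>t\<^sub>a\<^sub>c\<close>, \<open>t\<^sub>a\<^sub>b\<close>, \<open>t\<^sub>c\<^sub>b\<close>.
\<close>

lemma len_transpose_cover_iff:
  assumes u: "u \<in> S_inf" and ab: "1 \<le> a" "a < b"
  shows "len (u \<circ> transpose a b) = Suc (len u) \<longleftrightarrow>
    u a < u b \<and> (\<forall>c. a < c \<longrightarrow> c < b \<longrightarrow> \<not> (u a < u c \<and> u c < u b))"
proof
  assume len: "len (u \<circ> transpose a b) = Suc (len u)"
  have "u a < u b"
    using len_transpose_greater[OF u ab] len S_inf_eq_iff[OF u, of a b] ab
    by (metis less_Suc_eq less_irrefl_nat linorder_neqE_nat not_less_eq)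
  moreover have False if c: "a < c" "c < b" "u a < u c" "u c < u b" for c
  proof -
    let ?v = "u \<circ> transpose a c" and ?w = "u \<circ> transpose a c \<circ> transpose a b"
    have "len u < len ?v"
      using u ab c by (intro len_transpose_less) auto
    moreover have "len ?v < len ?w"
      using u ab c by (intro len_transpose_less) (auto simp: transpose_def)
    moreover have "len ?w < len (?w \<circ> transpose c b)"
      using u ab c by (intro len_transpose_less) (auto simp: transpose_def)
    moreover have "len (?w \<circ> transpose c b) = len (u \<circ> transpose a b)"
      using c by (intro arg_cong[of _ _ len]) (auto simp: fun_eq_iff transpose_def)
    ultimately show False
      using len by linarith
  qed
  ultimately show "u a < u b \<and> (\<forall>c. a < c \<longrightarrow> c < b \<longrightarrow> \<not> (u a < u c \<and> u c < u b))"
    by blast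
qed (use len_transpose_Suc[OF u ab] in blast)

lemma len_comp_adj_asc:
  assumes "u \<in> S_inf" "1 \<le> i" "u i < u (Suc i)"
  shows "len (u \<circ> transpose i (Suc i)) = Suc (len u)"
  using assms by (intro len_transpose_Suc) auto

lemma len_comp_adj_desc:
  assumes "u \<in> S_inf" "1 \<le> i" "u (Suc i) < u i"
  shows "len u = Suc (len (u \<circ> transpose i (Suc i)))"
  using len_comp_adj_asc[of "u \<circ> transpose i (Suc i)" i] assms by simp

lemma S_inf_inv_pos: "u \<in> S_inf \<Longrightarrow> 1 \<le> i \<Longrightarrow> 1 \<le> inv u i"
  using S_inf_pos[of "inv u" i] by simp

lemma inv_adj_comp: "u \<in> S_inf \<Longrightarrow> inv (transpose a b \<circ> u) = inv u \<circ> transpose a b"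
  by (simp add: o_inv_distrib S_inf_bij inv_swap_id)

lemma inv_comp_adj: "u \<in> S_inf \<Longrightarrow> inv (u \<circ> transpose a b) = transpose a b \<circ> inv u"
  by (simp add: o_inv_distrib S_inf_bij inv_swap_id)

text \<open>On the left, s_i is the exchange of the positions of i and i + 1, and no value lies
  strictly between these two.\<close>

lemma len_adj_comp_asc:
  assumes "u \<in> S_inf" "1 \<le> i" "inv u i < inv u (Suc i)"
  shows "len (transpose i (Suc i) \<circ> u) = Suc (len u)"
proof -
  have "transpose i (Suc i) \<circ> u = u \<circ> transpose (inv u i) (inv u (Suc i))"
    using assms by (intro transpose_comp_eq S_inf_bij)
  then show ?thesis
    using assms len_transpose_Suc[of u "inv u i" "inv u (Suc i)"] S_inf_inv_pos[of u i] by (auto simp: S_inf_inv_apply)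
qed

lemma len_adj_comp_desc:
  assumes "u \<in> S_inf" "1 \<le> i" "inv u (Suc i) < inv u i"
  shows "len u = Suc (len (transpose i (Suc i) \<circ> u))"
  using len_adj_comp_asc[of "transpose i (Suc i) \<circ> u" i] assms by (simp add: inv_adj_comp)

lemma S_inf_increasing_imp_id:
  assumes u: "u \<in> S_inf" and inc: "\<And>i. 1 \<le> i \<Longrightarrow> u i < u (Suc i)"
  shows "u = id"
proof -
  have "u i < u (Suc i)" for i
    using inc[of i] S_inf_0[OF u] S_inf_pos[OF u, of 1] by (cases "i = 0") auto
  then have mono: "strict_mono u"
    by (simp add: strict_mono_Suc_iff)
  have "strict_mono (inv u)"
    by (rule strict_monoI) (metis S_inf_inv_apply(1) mono strict_mono_less u)
  then have "i \<le> u i" "i \<le> inv u i" for i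
    using mono strict_mono_imp_increasing by blast+
  then have "u i = i" for i
    by (metis S_inf_inv_apply(1) le_antisym mono strict_mono_less_eq u)
  then show ?thesis
    by (simp add: fun_eq_iff)
qed

lemma w0_in_S_upto: "w0 n \<in> S_upto (n + 1)"
proof -
  have "w0 n permutes {1..n + 1}"
    by (rule bij_imp_permutes, rule bij_betw_byWitness[where f' = "w0 n"]) (auto simp: w0_def)
  then show ?thesis
    by (simp add: S_upto_iff_permutes)
qed

lemma w0_in_S_inf [simp]: "w0 n \<in> S_inf"
  using w0_in_S_upto S_upto_imp_S_inf by blast

lemma w0_w0 [simp]: "w0 n (w0 n i) = i"
  by (auto simp: w0_def)

lemma w0_less_iff:
  "i \<in> {1..n + 1} \<Longrightarrow> j \<in> {1..n + 1} \<Longrightarrow> w0 n i < w0 n j \<longleftrightarrow> j < i"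
  by (auto simp: w0_def)

text \<open>\<open>w0 n\<close> reverses the order of {1..n+1}, so without ascents
  \<open>w0 n \<circ> u\<close> would be increasing and thus the identity.\<close>

lemma S_upto_asc_exists:
  assumes u: "u \<in> S_upto (n + 1)" and "u \<noteq> w0 n"
  shows "\<exists>i. 1 \<le> i \<and> i \<le> n \<and> u i < u (Suc i)"
proof (rule ccontr)
  assume none: "\<not> ?thesis"
  have up: "u permutes {1..n + 1}" and u': "u \<in> S_inf"
    using u by (simp_all add: S_upto_iff_permutes S_upto_imp_S_inf)
  have "w0 n \<circ> u = id"
  proof (rule S_inf_increasing_imp_id)
    fix i :: nat assume i: "1 \<le> i"
    show "(w0 n \<circ> u) i < (w0 n \<circ> u) (Suc i)"
    proof (cases "i \<le> n")
      case True
      then have "u (Suc i) < u i"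
        using none i S_inf_eq_iff[OF u', of i "Suc i"] by (metis linorder_neqE_nat n_not_Suc_n)
      then show ?thesis
        using permutes_in_image[OF up, of i] permutes_in_image[OF up, of "Suc i"] i True
        by (auto simp: w0_less_iff)
    next
      case False
      then have "u (Suc i) = Suc i"
        using permutes_not_in[OF up, of "Suc i"] by simp
      moreover have "u i \<le> i"
        using False permutes_in_image[OF up, of i] permutes_not_in[OF up, of i] i
        by (cases "i \<in> {1..n+1}") auto
      ultimately show ?thesis
        using False i by (auto simp: w0_def)
    qed
  qed (use u' in simp)
  then have "u i = w0 n i" for i
    by (metis comp_apply id_apply w0_w0)
  then show False
    using assms(2) by auto
qed

section \<open>Reduced words\<close>

lemma apply_adj_transps_in_S_inf: "\<forall>i\<in>set ks. 1 \<le> i \<Longrightarrow> apply_adj_transps ks \<in> S_inf"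
  by (induction ks) auto

lemma reduced_word_Nil [simp]: "reduced_word id []"
proof -
  have "inversions id = {}"
    by (auto simp: inversions_def)
  then show ?thesis
    by (simp add: reduced_word_def len_eq_card_inversions)
qed

lemma reduced_word_in_S_inf: "reduced_word u ks \<Longrightarrow> u \<in> S_inf"
  using apply_adj_transps_in_S_inf by (auto simp: reduced_word_def)

lemma len_adj_comp_le:
  assumes "u \<in> S_inf" "1 \<le> i"
  shows "len (transpose i (Suc i) \<circ> u) \<le> Suc (len u)"
proof (cases "inv u i < inv u (Suc i)")
  case True
  then show ?thesis
    using len_adj_comp_asc[OF assms] by simp
next
  case False
  then have "inv u (Suc i) < inv u i"
    using assms S_inf_eq_iff[of "inv u" i "Suc i"] by (simp add: not_less le_less)
  then show ?thesis
    using len_adj_comp_desc[OF assms] by simp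
qed

lemma len_apply_adj_transps_le: "\<forall>i\<in>set ks. 1 \<le> i \<Longrightarrow> len (apply_adj_transps ks) \<le> length ks"
proof (induction ks)
  case Nil
  then show ?case
    using reduced_word_Nil by (simp add: reduced_word_def id_def)
next
  case (Cons k ks)
  then have "apply_adj_transps ks \<in> S_inf"
    by (intro apply_adj_transps_in_S_inf) auto
  then show ?case
    using Cons len_adj_comp_le[of "apply_adj_transps ks" k] by (simp add: o_def)
qed

text \<open>If i stood before i + 1, removing the first letter would raise the length to
  \<open>len u + 1\<close>, while only \<open>len u - 1\<close> letters remain.\<close>

lemma reduced_word_Cons_iff:
  assumes "1 \<le> i"
  shows "reduced_word u (i # ks) \<longleftrightarrow>
    u \<in> S_inf \<and> inv u (Suc i) < inv u i \<and> reduced_word (transpose i (Suc i) \<circ> u) ks"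
proof
  assume red: "reduced_word u (i # ks)"
  let ?v = "apply_adj_transps ks"
  have u: "u = transpose i (Suc i) \<circ> ?v" and ks: "\<forall>i\<in>set ks. 1 \<le> i" and len: "Suc (length ks) = len u"
    using red by (auto simp: reduced_word_def)
  have v: "?v \<in> S_inf"
    by (rule apply_adj_transps_in_S_inf) fact
  have uv: "transpose i (Suc i) \<circ> u = ?v"
    unfolding u by simp
  have "\<not> inv u i < inv u (Suc i)"
    using len_adj_comp_asc[OF reduced_word_in_S_inf[OF red] assms] len_apply_adj_transps_le[OF ks] len
    unfolding uv by auto
  then have "inv u (Suc i) < inv u i"
    using S_inf_eq_iff[OF inv_in_S_inf[OF reduced_word_in_S_inf[OF red]], of i "Suc i"]
    by (simp add: not_less le_less)
  moreover have "reduced_word ?v ks"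
    using ks len len_adj_comp_desc[OF reduced_word_in_S_inf[OF red] assms] calculation
    unfolding uv by (simp add: reduced_word_def)
  ultimately show "u \<in> S_inf \<and> inv u (Suc i) < inv u i \<and> reduced_word (transpose i (Suc i) \<circ> u) ks"
    using reduced_word_in_S_inf[OF red] uv by simp
next
  assume *: "u \<in> S_inf \<and> inv u (Suc i) < inv u i \<and> reduced_word (transpose i (Suc i) \<circ> u) ks"
  then have "apply_adj_transps (i # ks) = u"
    by (simp add: reduced_word_def)
  then show "reduced_word u (i # ks)"
    using * assms len_adj_comp_desc[of u i] by (auto simp: reduced_word_def)
qed

lemma reduced_word_exists:
  assumes "u \<in> S_inf"
  shows "\<exists>ks. reduced_word u ks"
  using assms
proof (induction "len u" arbitrary: u)
  case 0
  have "inv u i < inv u (Suc i)" if "1 \<le> i" for i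
    using that 0 len_adj_comp_desc[of u i] S_inf_eq_iff[of "inv u" i "Suc i"]
    by (metis inv_in_S_inf linorder_neqE_nat n_not_Suc_n nat.simps(3))
  then have "inv u = id"
    using 0 by (intro S_inf_increasing_imp_id) auto
  then have "u = id"
    using 0 by (metis S_inf_bij bij_imp_bij_inv inv_inv_eq inv_id)
  then show ?case
    using reduced_word_Nil by blast
next
  case (Suc n)
  show ?case
  proof (cases "\<exists>i\<ge>1. inv u (Suc i) < inv u i")
    case True
    then obtain i where i: "1 \<le> i" "inv u (Suc i) < inv u i"
      by blast
    then obtain ks where "reduced_word (transpose i (Suc i) \<circ> u) ks"
      using Suc(1)[of "transpose i (Suc i) \<circ> u"] Suc(2,3) len_adj_comp_desc[of u i] by auto
    then have "reduced_word u (i # ks)"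
      using i Suc(3) reduced_word_Cons_iff by simp
    then show ?thesis ..
  next
    case False
    then have "inv u i < inv u (Suc i)" if "1 \<le> i" for i
      using that Suc(3) S_inf_eq_iff[of "inv u" i "Suc i"]
      by (metis inv_in_S_inf linorder_neqE_nat n_not_Suc_n)
    then have "inv u = id"
      using Suc by (intro S_inf_increasing_imp_id) auto
    then have "u = id"
      using Suc by (metis S_inf_bij bij_imp_bij_inv inv_inv_eq inv_id)
    then show ?thesis
      using reduced_word_Nil by blast
  qed
qed

section \<open>Independence of the reduced word, and nil-Coxeter relations\<close>

lemma ddiff_commute:
  "Suc i < j \<Longrightarrow> ddiff i (ddiff j P) = ddiff j (ddiff i P)"
  unfolding ddiff_eq by (rule div_diff_commute) auto

lemma ddiff_braid:
  "ddiff i (ddiff (Suc i) (ddiff i P)) = ddiff (Suc i) (ddiff i (ddiff (Suc i) P))"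
  unfolding ddiff_eq using div_diff_braid[of "VX i" "VX (Suc i)" "VX (Suc (Suc i))"] by simp

text \<open>
  Matsumoto's argument: if a permutation has reduced words starting with \<open>i\<close> and with \<open>j\<close>, then it
  also has reduced words starting with the two sides of the braid relation between \<open>i\<close> and \<open>j\<close>.
\<close>

lemma foldr_ddiff_reduced_word_unique:
  assumes "reduced_word u ks" "reduced_word u ls"
  shows "foldr ddiff ks = foldr ddiff ls"
  using assms
proof (induction "length ks" arbitrary: u ks ls rule: less_induct)
  case less
  have len: "length ks = length ls"
    using less.prems by (simp add: reduced_word_def)
  show ?case
  proof (cases ks)
    case Nil
    then show ?thesis
      using len by simp
  next
    case (Cons i ks')
    then obtain j ls' where ls: "ls = j # ls'"
      using len by (cases ls) auto
    have ij: "1 \<le> i" "1 \<le> j"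
      using less.prems Cons ls by (auto simp: reduced_word_def)
    have u: "u \<in> S_inf"
      using less.prems(1) by (rule reduced_word_in_S_inf)
    let ?s = "\<lambda>i. transpose i (Suc i) :: nat \<Rightarrow> nat"
    have di: "inv u (Suc i) < inv u i" and ks': "reduced_word (?s i \<circ> u) ks'"
      using less.prems(1) ij unfolding Cons by (simp_all add: reduced_word_Cons_iff)
    have dj: "inv u (Suc j) < inv u j" and ls': "reduced_word (?s j \<circ> u) ls'"
      using less.prems(2) ij unfolding ls by (simp_all add: reduced_word_Cons_iff)
    have IH: "foldr ddiff ms = foldr ddiff ms'"
      if "reduced_word v ms" "reduced_word v ms'" "length ms < length ks" for v ms ms'
      using less.hyps that by blast
    have far: "foldr ddiff (a # as) = foldr ddiff (b # bs)"
      if ab: "Suc a < b" "1 \<le> a" "inv u (Suc a) < inv u a" "inv u (Suc b) < inv u b"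
        "reduced_word (?s a \<circ> u) as" "reduced_word (?s b \<circ> u) bs"
        "length as < length ks" "length bs < length ks" for a b as bs
    proof -
      obtain ms where ms: "reduced_word (?s b \<circ> (?s a \<circ> u)) ms"
        using reduced_word_exists[of "?s b \<circ> (?s a \<circ> u)"] u ab by auto
      have comm: "?s a \<circ> (?s b \<circ> u) = ?s b \<circ> (?s a \<circ> u)"
        using that by (auto simp: fun_eq_iff transpose_def)
      have "reduced_word (?s a \<circ> u) (b # ms)"
        using that u ms by (subst reduced_word_Cons_iff) (auto simp: inv_adj_comp transpose_def)
      moreover have "reduced_word (?s b \<circ> u) (a # ms)"
        using that u ms by (subst reduced_word_Cons_iff) (auto simp: inv_adj_comp transpose_def comm)
      ultimately have "foldr ddiff as = foldr ddiff (b # ms)" "foldr ddiff bs = foldr ddiff (a # ms)"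
        using that IH by blast+
      then show ?thesis
        using ddiff_commute[OF ab(1)] by (simp add: fun_eq_iff)
    qed
    have near: "foldr ddiff (a # as) = foldr ddiff (Suc a # bs)"
      if a: "1 \<le> a" "inv u (Suc a) < inv u a" "inv u (Suc (Suc a)) < inv u (Suc a)"
        "reduced_word (?s a \<circ> u) as" "reduced_word (?s (Suc a) \<circ> u) bs"
        "length as < length ks" "length bs < length ks" for a as bs
    proof -
      let ?x = "?s a \<circ> (?s (Suc a) \<circ> (?s a \<circ> u))"
      obtain ms where ms: "reduced_word ?x ms"
        using reduced_word_exists[of ?x] u a by auto
      have braid: "?s (Suc a) \<circ> (?s a \<circ> (?s (Suc a) \<circ> u)) = ?x"
        by (auto simp: fun_eq_iff transpose_def)
      have "reduced_word (?s a \<circ> u) (Suc a # a # ms)"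
        using that u ms by (auto simp: reduced_word_Cons_iff inv_adj_comp transpose_def)
      moreover have "reduced_word (?s (Suc a) \<circ> u) (a # Suc a # ms)"
        using that u ms by (auto simp: reduced_word_Cons_iff inv_adj_comp transpose_def braid)
      ultimately have "foldr ddiff as = foldr ddiff (Suc a # a # ms)"
          "foldr ddiff bs = foldr ddiff (a # Suc a # ms)"
        using that IH by blast+
      then show ?thesis
        by (simp add: fun_eq_iff ddiff_braid)
    qed
    consider "i = j" | "Suc i < j" | "Suc j < i" | "j = Suc i" | "i = Suc j"
      by linarith
    then show ?thesis
    proof cases
      case 1
      then show ?thesis
        using IH[OF ks'] ls' Cons ls by auto
    next
      case 2
      then show ?thesis
        unfolding Cons ls using ij di dj ks' ls' Cons ls len by (intro far) auto
    next
      case 3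
      then show ?thesis
        unfolding Cons ls using ij di dj ks' ls' Cons ls len by (intro far[symmetric]) auto
    next
      case 4
      then have "foldr ddiff (i # ks') = foldr ddiff (Suc i # ls')"
        using ij di dj ks' ls' Cons ls len by (intro near) auto
      then show ?thesis
        unfolding Cons ls 4 .
    next
      case 5
      then have "foldr ddiff (j # ls') = foldr ddiff (Suc j # ks')"
        using ij di dj ks' ls' Cons ls len by (intro near) auto
      then show ?thesis
        unfolding Cons ls 5 by (rule sym)
    qed
  qed
qed

lemma ddiff_perm_reduced_word: "reduced_word u ks \<Longrightarrow> ddiff_perm u P = foldr ddiff ks P"
  unfolding ddiff_perm_def
  by (rule fun_cong[OF foldr_ddiff_reduced_word_unique]) (rule someI)

lemma ddiff_perm_id [simp]: "ddiff_perm id P = P"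
  using ddiff_perm_reduced_word[OF reduced_word_Nil] by simp

lemma ddiff_ddiff [simp]: "ddiff i (ddiff i P) = 0"
  by (simp add: ddiff_eq)

lemma ddiff_0 [simp]: "ddiff i 0 = 0"
  by (simp add: ddiff_eq)

text \<open>In the second case \<open>u\<close> has a reduced word beginning with \<open>i\<close>,
  and \<open>ddiff i\<close> applied twice is zero.\<close>

lemma ddiff_ddiff_perm:
  assumes u: "u \<in> S_inf" and i: "1 \<le> i"
  shows "ddiff i (ddiff_perm u P) =
    (if inv u i < inv u (Suc i) then ddiff_perm (transpose i (Suc i) \<circ> u) P else 0)"
proof -
  obtain ks where ks: "reduced_word u ks"
    using reduced_word_exists[OF u] ..
  show ?thesis
  proof (cases "inv u i < inv u (Suc i)")
    case True
    then have "reduced_word (transpose i (Suc i) \<circ> u) (i # ks)"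
      using u i ks by (simp add: reduced_word_Cons_iff inv_adj_comp)
    then show ?thesis
      using True ks by (simp add: ddiff_perm_reduced_word)
  next
    case False
    then have desc: "inv u (Suc i) < inv u i"
      using S_inf_eq_iff[OF inv_in_S_inf[OF u], of i "Suc i"] by simp
    obtain ls where "reduced_word (transpose i (Suc i) \<circ> u) ls"
      using reduced_word_exists[of "transpose i (Suc i) \<circ> u"] u i by auto
    then have "reduced_word u (i # ls)"
      using u i desc by (simp add: reduced_word_Cons_iff)
    then show ?thesis
      using False by (simp add: ddiff_perm_reduced_word)
  qed
qed

lemma reduced_word_snoc:
  assumes "reduced_word u ks" "1 \<le> j" "u j < u (Suc j)"
  shows "reduced_word (u \<circ> transpose j (Suc j)) (ks @ [j])"
  using assms len_comp_adj_asc[OF reduced_word_in_S_inf[OF assms(1)]] by (auto simp: reduced_word_def)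

text \<open>Here the letter joins the inner end of the word. This is where a divided difference in
  the y variables arrives: it commutes past the whole word and changes only the innermost
  polynomial.\<close>

lemma ddiff_perm_ddiff:
  assumes u: "u \<in> S_inf" and j: "1 \<le> j"
  shows "ddiff_perm u (ddiff j P) =
    (if u j < u (Suc j) then ddiff_perm (u \<circ> transpose j (Suc j)) P else 0)"
proof (cases "u j < u (Suc j)")
  case True
  obtain ks where ks: "reduced_word u ks"
    using reduced_word_exists[OF u] ..
  then show ?thesis
    using ddiff_perm_reduced_word[OF ks] ddiff_perm_reduced_word[OF reduced_word_snoc[OF ks j True]] True
    by simp
next
  case False
  let ?v = "u \<circ> transpose j (Suc j)"
  obtain ks where ks: "reduced_word ?v ks"
    using reduced_word_exists[of ?v] u j by auto
  have "u (Suc j) < u j"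
    using False S_inf_eq_iff[OF u, of j "Suc j"] by simp
  then have "reduced_word u (ks @ [j])"
    using reduced_word_snoc[OF ks j] by simp
  moreover have "foldr ddiff ks 0 = 0"
    by (induction ks) auto
  ultimately show ?thesis
    using False by (simp add: ddiff_perm_reduced_word)
qed

section \<open>Double Schubert polynomials\<close>

text \<open>A product over the boxes of a diagram with row lengths \<open>\<rho>\<close>; for weakly
  decreasing \<open>\<rho>\<close> it is the double Schubert polynomial of the dominant permutation
  with code \<open>\<rho>\<close>.\<close>

definition dominant_poly :: "nat \<Rightarrow> (nat \<Rightarrow> nat) \<Rightarrow> mpoly" where
  "dominant_poly N \<rho> = (\<Prod>i\<in>{1..N}. \<Prod>j\<in>{1..\<rho> i}. Var (VX i) - Var (VY j))"

lemma dominant_poly_cong: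
  "(\<And>i. 1 \<le> i \<Longrightarrow> i \<le> N \<Longrightarrow> \<rho> i = \<mu> i) \<Longrightarrow> dominant_poly N \<rho> = dominant_poly N \<mu>"
  unfolding dominant_poly_def by (intro prod.cong) auto

lemma swap_var_x_dominant_poly:
  assumes "1 \<le> c" "Suc c \<le> N" "\<rho> c = \<rho> (Suc c)"
  shows "swap_var (VX c) (VX (Suc c)) (dominant_poly N \<rho>) = dominant_poly N \<rho>"
proof -
  let ?s = "transpose c (Suc c)"
  have VX: "transpose (VX c) (VX (Suc c)) (VX i) = VX (?s i)"
    and VY: "transpose (VX c) (VX (Suc c)) (VY j) = VY j" for i j
    by (auto simp: transpose_def)
  have "swap_var (VX c) (VX (Suc c)) (dominant_poly N \<rho>) =
      (\<Prod>i\<in>{1..N}. \<Prod>j\<in>{1..\<rho> (?s i)}. Var (VX (?s i)) - Var (VY j))"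
    unfolding dominant_poly_def swap_var_prod swap_var_simps VX VY
    using assms by (intro prod.cong) (auto simp: transpose_def)
  also have "\<dots> = dominant_poly N \<rho>"
    unfolding dominant_poly_def
    by (rule prod.reindex_bij_witness[of _ ?s ?s]) (use assms in \<open>auto simp: transpose_def\<close>)
  finally show ?thesis .
qed

text \<open>No row ends in column c, so each row contains both of the columns c and c + 1 or
  neither.\<close>

lemma swap_var_y_dominant_poly:
  assumes "1 \<le> c" "\<And>i. 1 \<le> i \<Longrightarrow> i \<le> N \<Longrightarrow> \<rho> i \<noteq> c"
  shows "swap_var (VY c) (VY (Suc c)) (dominant_poly N \<rho>) = dominant_poly N \<rho>"
proof -
  let ?s = "transpose c (Suc c)"
  have VX: "transpose (VY c) (VY (Suc c)) (VX i) = VX i"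
    and VY: "transpose (VY c) (VY (Suc c)) (VY j) = VY (?s j)" for i j
    by (auto simp: transpose_def)
  show ?thesis
    unfolding dominant_poly_def swap_var_prod swap_var_simps VX VY
  proof (rule prod.cong[OF refl])
    fix i assume "i \<in> {1..N}"
    then have "\<rho> i \<noteq> c"
      using assms by auto
    then show "(\<Prod>j\<in>{1..\<rho> i}. Var (VX i) - Var (VY (?s j))) = (\<Prod>j\<in>{1..\<rho> i}. Var (VX i) - Var (VY j))"
      using assms(1) by (intro prod.reindex_bij_witness[of _ ?s ?s]) (auto simp: transpose_def)
  qed
qed

lemma dominant_poly_Suc:
  assumes "1 \<le> c" "c \<le> N" "\<mu> c = Suc (\<rho> c)" "\<And>i. i \<noteq> c \<Longrightarrow> \<mu> i = \<rho> i"
  shows "dominant_poly N \<mu> = (Var (VX c) - Var (VY (Suc (\<rho> c)))) * dominant_poly N \<rho>"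
proof -
  have c: "{1..N} = insert c ({1..N} - {c})"
    using assms by auto
  have "(\<Prod>i\<in>{1..N} - {c}. \<Prod>j\<in>{1..\<mu> i}. Var (VX i) - Var (VY j)) =
      (\<Prod>i\<in>{1..N} - {c}. \<Prod>j\<in>{1..\<rho> i}. Var (VX i) - Var (VY j))"
    using assms(4) by (intro prod.cong) auto
  then show ?thesis
    unfolding dominant_poly_def using assms(3)
    by (subst (1 2) c) (simp add: prod.insert_remove algebra_simps)
qed

text \<open>Row c exceeds row c + 1 by a single box; without that box the product is symmetric in
  x_c and x_{c+1}.\<close>

lemma ddiff_dominant_poly:
  assumes "1 \<le> c" "Suc c \<le> N" "\<mu> c = Suc (\<mu> (Suc c))" "\<rho> c = \<mu> (Suc c)" "\<And>i. i \<noteq> c \<Longrightarrow> \<rho> i = \<mu> i"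
  shows "ddiff c (dominant_poly N \<mu>) = dominant_poly N \<rho>"
proof -
  have \<mu>: "dominant_poly N \<mu> = (Var (VX c) - Var (VY (Suc (\<rho> c)))) * dominant_poly N \<rho>"
    using assms by (intro dominant_poly_Suc) auto
  have "swap_var (VX c) (VX (Suc c)) (dominant_poly N \<rho>) = dominant_poly N \<rho>"
    using assms by (intro swap_var_x_dominant_poly) auto
  then show ?thesis
    unfolding \<mu> ddiff_eq by (simp add: div_diff_Var_mult)
qed

text \<open>Truncated subtraction makes the rows beyond n empty. The free \<open>N\<close> allows
  staircases for different n to be compared over the same rows.\<close>

lemma schubert_w0_eq:
  assumes "n \<le> N"
  shows "schubert_w0 n = dominant_poly N (\<lambda>i. n + 1 - i)"
proof -
  have "{(i, j). 1 \<le> i \<and> 1 \<le> j \<and> i + j \<le> n + 1} = (SIGMA i:{1..N}. {1..n + 1 - i})"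
    using assms by auto
  then show ?thesis
    unfolding schubert_w0_def dominant_poly_def by (simp add: prod.Sigma)
qed

section \<open>Schubert polynomials computed in a fixed symmetric group\<close>

lemma inv_w0 [simp]: "inv (w0 n) = w0 n"
  by (rule inv_equality) simp_all

lemma ddiff_schubert_at:
  assumes u: "u \<in> S_upto (n + 1)" and i: "1 \<le> i" "i \<le> n"
  shows "ddiff i (schubert_at n u) =
    (if u (Suc i) < u i then schubert_at n (u \<circ> transpose i (Suc i)) else 0)"
proof -
  have u': "u \<in> S_inf"
    using u by (rule S_upto_imp_S_inf)
  have up: "u permutes {1..n + 1}"
    using u by (simp add: S_upto_iff_permutes)
  have inv: "inv (inv u \<circ> w0 n) j = w0 n (u j)" for j
    using u' by (simp add: o_inv_distrib S_inf_bij inv_inv_eq inv_w0)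
  have "w0 n (u i) < w0 n (u (Suc i)) \<longleftrightarrow> u (Suc i) < u i"
    using permutes_in_image[OF up] i by (intro w0_less_iff) auto
  moreover have "transpose i (Suc i) \<circ> (inv u \<circ> w0 n) = inv (u \<circ> transpose i (Suc i)) \<circ> w0 n"
    using u' by (simp add: inv_comp_adj o_assoc)
  ultimately show ?thesis
    unfolding schubert_at_def using u' i by (simp add: ddiff_ddiff_perm inv del: o_apply)
qed

lemma schubert_at_w0 [simp]: "schubert_at n (w0 n) = schubert_w0 n"
proof -
  have "inv (w0 n) \<circ> w0 n = id"
    by (simp add: fun_eq_iff)
  then show ?thesis
    unfolding schubert_at_def by (simp del: inv_w0)
qed

text \<open>The induction hypothesis covers every longer permutation of S_{n+1}, not only u s_i: for
  an ascent at k the proof of \<open>top_pieri\<close> moves to some s_j u instead.\<close>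

lemma S_upto_descending_induct [consumes 1, case_names w0 asc]:
  assumes "u \<in> S_upto (n + 1)"
    and w0: "P (w0 n)"
    and asc: "\<And>u i. u \<in> S_upto (n + 1) \<Longrightarrow> 1 \<le> i \<Longrightarrow> i \<le> n \<Longrightarrow> u i < u (Suc i) \<Longrightarrow>
      (\<And>v. v \<in> S_upto (n + 1) \<Longrightarrow> len u < len v \<Longrightarrow> P v) \<Longrightarrow> P u"
  shows "P u"
  using assms(1)
proof (induction "(n + 1) * (n + 1) - len u" arbitrary: u rule: less_induct)
  case less
  show ?case
  proof (cases "u = w0 n")
    case False
    then obtain i where i: "1 \<le> i" "i \<le> n" "u i < u (Suc i)"
      using S_upto_asc_exists less.prems by blast
    have "P v" if "v \<in> S_upto (n + 1)" "len u < len v" for v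
      using that less.prems len_S_upto_le[OF that(1)] by (intro less.hyps) auto
    then show ?thesis
      using asc less.prems i by blast
  qed (simp add: w0)
qed

text \<open>
  The permutation with code \<open>(n + [1 \<in> A], n - 1 + [2 \<in> A], \<dots>)\<close>.  It is \<open>w0 n\<close> followed by the
  cycle which runs through \<open>A\<close> and the position \<open>n + 2\<close>.
\<close>

definition pred_in :: "nat set \<Rightarrow> nat \<Rightarrow> nat" where
  "pred_in A i = Max (insert 0 {a \<in> A. a < i})"

definition w0_plus :: "nat \<Rightarrow> nat set \<Rightarrow> nat \<Rightarrow> nat" where
  "w0_plus n A i = (if i \<in> insert (n + 2) A then n + 2 - pred_in A i else w0 n i)"

lemma pred_in_cong: "(\<And>a. a < i \<Longrightarrow> a \<in> A \<longleftrightarrow> a \<in> B) \<Longrightarrow> pred_in A i = pred_in B i"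
  unfolding pred_in_def by (intro arg_cong[of _ _ Max] arg_cong[of _ _ "insert 0"]) auto

lemma pred_in_eqI: "a \<in> A \<Longrightarrow> a < i \<Longrightarrow> (\<And>b. b \<in> A \<Longrightarrow> b < i \<Longrightarrow> b \<le> a) \<Longrightarrow> pred_in A i = a"
  unfolding pred_in_def by (rule Max_eqI) auto

lemma pred_in_eq_0I:
  assumes "\<And>a. a \<in> A \<Longrightarrow> i \<le> a"
  shows "pred_in A i = 0"
proof -
  have "{a \<in> A. a < i} = {}"
    using assms by fastforce
  then show ?thesis
    by (simp only: pred_in_def Max_singleton)
qed

lemma pred_in_cases: "pred_in A i = 0 \<or> pred_in A i \<in> A \<and> pred_in A i < i"
proof -
  have "pred_in A i \<in> insert 0 {a \<in> A. a < i}"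
    unfolding pred_in_def by (rule Max_in) auto
  then show ?thesis
    by auto
qed

lemma pred_in_ge: "a \<in> A \<Longrightarrow> a < i \<Longrightarrow> a \<le> pred_in A i"
  unfolding pred_in_def by (rule Max_ge) auto

lemma w0_plus_empty: "w0_plus n {} = w0 n"
  by (auto simp: w0_plus_def pred_in_def w0_def)

lemma w0_plus_full: "w0_plus n {1..n + 1} = w0 (n + 1)"
proof
  fix i
  have "pred_in {1..n + 1} i = i - 1" if "1 \<le> i" "i \<le> n + 2"
  proof (cases "i = 1")
    case True
    then show ?thesis
      by (auto intro: pred_in_eq_0I)
  next
    case False
    then show ?thesis
      using that by (intro pred_in_eqI) auto
  qed
  then show "w0_plus n {1..n + 1} i = w0 (n + 1) i"
    by (auto simp: w0_plus_def w0_def)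
qed

text \<open>When c enters the cycle, it inherits the old predecessor of c + 1 and becomes the new
  one, so the values at c and c + 1 trade places.\<close>

lemma w0_plus_remove:
  assumes A: "A \<subseteq> {1..n + 1}" and c: "1 \<le> c" "c \<le> n + 1" "c \<notin> A" and Suc_c: "Suc c \<in> insert (n + 2) A"
  shows "w0_plus n A = w0_plus n (insert c A) \<circ> transpose c (Suc c)"
    and "w0_plus n (insert c A) (Suc c) < w0_plus n (insert c A) c"
proof -
  have pc: "pred_in (insert c A) (Suc c) = c"
    by (rule pred_in_eqI) auto
  have "{a \<in> A. a < Suc c} = {a \<in> A. a < c}"
    using c by (auto simp: less_Suc_eq)
  then have "pred_in A (Suc c) = pred_in A c"
    unfolding pred_in_def by simp
  moreover have "pred_in (insert c A) c = pred_in A c"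
    by (rule pred_in_cong) auto
  ultimately have pA: "pred_in (insert c A) c = pred_in A c" "pred_in A (Suc c) = pred_in A c"
    by simp_all
  have pi: "pred_in (insert c A) i = pred_in A i" if "i \<in> insert (n + 2) A" "i \<noteq> Suc c" for i
  proof (cases "i \<le> c")
    case True
    then show ?thesis
      by (intro pred_in_cong) auto
  next
    case False
    then have "Suc c \<in> A" "Suc c < i"
      using that A Suc_c by auto
    then have "Suc c \<le> pred_in A i"
      by (rule pred_in_ge)
    then have "pred_in A i \<in> A" "pred_in A i < i"
      using pred_in_cases[of A i] by auto
    then show ?thesis
      using \<open>Suc c \<le> pred_in A i\<close> by (intro pred_in_eqI) (auto intro: pred_in_ge)
  qed
  show "w0_plus n (insert c A) (Suc c) < w0_plus n (insert c A) c"
    using c Suc_c pred_in_cases[of A c] by (auto simp: w0_plus_def pc pA)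
  show "w0_plus n A = w0_plus n (insert c A) \<circ> transpose c (Suc c)"
  proof
    fix i
    show "w0_plus n A i = (w0_plus n (insert c A) \<circ> transpose c (Suc c)) i"
      using c Suc_c pc pA pi[of i]
      by (cases "i = c"; cases "i = Suc c") (auto simp: w0_plus_def w0_def)
  qed
qed

lemma schubert_at_w0_plus_aux:
  assumes "A \<subseteq> {1..n + 1}"
  shows "w0_plus n A \<in> S_upto (n + 2) \<and>
    schubert_at (n + 1) (w0_plus n A) = dominant_poly (n + 2) (\<lambda>i. n + 1 - i + of_bool (i \<in> A))"
  using assms
proof (induction "card ({1..n + 1} - A)" arbitrary: A)
  case 0
  then have A: "A = {1..n + 1}"
    by auto
  have "schubert_at (n + 1) (w0_plus n A) = dominant_poly (n + 2) (\<lambda>i. n + 1 + 1 - i)"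
    unfolding A w0_plus_full schubert_at_w0 by (rule schubert_w0_eq) simp
  also have "\<dots> = dominant_poly (n + 2) (\<lambda>i. n + 1 - i + of_bool (i \<in> A))"
    by (rule dominant_poly_cong) (auto simp: A)
  finally show ?case
    unfolding A w0_plus_full using w0_in_S_upto[of "n + 1"] by simp
next
  case (Suc m)
  let ?C = "{1..n + 1} - A"
  \<comment> \<open>For the largest missing position, c + 1 is in A or equals n + 2, so row c for
    \<open>insert c A\<close> is exactly one box longer than row c + 1. Any other missing c with c +
    1 also missing would give a difference of two.\<close>
  define c where "c = Max ?C"
  have "?C \<noteq> {}"
    using Suc(2) by (metis Zero_not_Suc card.empty)
  then have "c \<in> ?C"
    unfolding c_def by (intro Max_in) auto
  then have c: "1 \<le> c" "c \<le> n + 1" "c \<notin> A"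
    by auto
  have "Suc c \<notin> ?C"
    using Max_ge[of ?C "Suc c"] unfolding c_def[symmetric] by (metis finite_Diff finite_atLeastAtMost not_less_eq_eq order_refl)
  then have Suc_c: "Suc c \<in> insert (n + 2) A"
    using c by auto
  have "?C = insert c ({1..n + 1} - insert c A)"
    using \<open>c \<in> ?C\<close> by auto
  then have "m = card ({1..n + 1} - insert c A)"
    using Suc(2) by (metis DiffE card_insert_disjoint finite_Diff finite_atLeastAtMost insertI1 old.nat.inject)
  then have IH: "w0_plus n (insert c A) \<in> S_upto (n + 2)"
      "schubert_at (n + 1) (w0_plus n (insert c A)) =
        dominant_poly (n + 2) (\<lambda>i. n + 1 - i + of_bool (i \<in> insert c A))"
    using Suc(1)[of "insert c A"] Suc(3) c by auto
  note rem = w0_plus_remove[OF Suc(3) c Suc_c]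
  have "w0_plus n A \<in> S_upto (n + 2)"
    unfolding rem(1) using IH(1) c by (intro S_upto_transpose) auto
  moreover have "schubert_at (n + 1) (w0_plus n A) = ddiff c (schubert_at (n + 1) (w0_plus n (insert c A)))"
    using ddiff_schubert_at[of "w0_plus n (insert c A)" "n + 1" c] IH(1) c rem by simp
  moreover have "\<dots> = dominant_poly (n + 2) (\<lambda>i. n + 1 - i + of_bool (i \<in> A))"
    unfolding IH(2) using c Suc_c Suc(3) by (intro ddiff_dominant_poly) auto
  ultimately show ?case
    by simp
qed

lemma schubert_at_w0_plus:
  assumes "A \<subseteq> {1..n + 1}"
  shows "schubert_at (n + 1) (w0_plus n A) = schubert_w0 n * (\<Prod>i\<in>A. Var (VX i) - Var (VY (n + 2 - i)))"
proof -
  have "dominant_poly (n + 2) (\<lambda>i. n + 1 - i + of_bool (i \<in> A)) =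
      schubert_w0 n * (\<Prod>i\<in>A. Var (VX i) - Var (VY (n + 2 - i)))"
    using finite_subset[OF assms finite_atLeastAtMost] assms
  proof (induction A rule: finite_induct)
    case empty
    then show ?case
      by (simp add: schubert_w0_eq[of n "n + 2"])
  next
    case (insert a A)
    have "dominant_poly (n + 2) (\<lambda>i. n + 1 - i + of_bool (i \<in> insert a A)) =
        (Var (VX a) - Var (VY (Suc (n + 1 - a + of_bool (a \<in> A))))) *
          dominant_poly (n + 2) (\<lambda>i. n + 1 - i + of_bool (i \<in> A))"
      using insert by (intro dominant_poly_Suc) auto
    also have "Suc (n + 1 - a + of_bool (a \<in> A)) = n + 2 - a"
      using insert by auto
    finally show ?case
      using insert by (simp add: algebra_simps)
  qed
  then show ?thesis
    using schubert_at_w0_plus_aux[OF assms] by simp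
qed

text \<open>The family \<open>w0_plus\<close> at the empty set settles the longest element of the
  smaller group; from there both sides descend by the same divided differences.\<close>

lemma schubert_at_Suc:
  assumes "u \<in> S_upto (n + 1)"
  shows "schubert_at (n + 1) u = schubert_at n u"
  using assms
proof (induction rule: S_upto_descending_induct)
  case w0
  show ?case
    using schubert_at_w0_plus[of "{}" n] by (simp add: w0_plus_empty)
next
  case (asc u i)
  let ?v = "u \<circ> transpose i (Suc i)"
  have v: "?v \<in> S_upto (n + 1)"
    using asc by (intro S_upto_transpose) auto
  moreover have "len u < len ?v"
    using asc len_comp_adj_asc[OF S_upto_imp_S_inf[OF asc(1)]] by (simp del: o_apply)
  ultimately have "schubert_at (n + 1) ?v = schubert_at n ?v"
    by (rule asc.IH)
  moreover have "ddiff i (schubert_at m ?v) = schubert_at m u" if "m \<ge> n" for m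
    using ddiff_schubert_at[of ?v m i] S_upto_mono[OF v, of "m + 1"] asc that by simp
  ultimately show ?case
    by (metis le_add1 order_refl)
qed

lemma schubert_eq_schubert_at:
  assumes "u \<in> S_upto (n + 1)"
  shows "schubert u = schubert_at n u"
proof -
  have eq: "schubert_at (n + m) u = schubert_at n u" if "u \<in> S_upto (n + 1)" for n m
  proof (induction m)
    case (Suc m)
    then show ?case
      using schubert_at_Suc[of u "n + m"] S_upto_mono[OF that, of "n + m + 1"] by simp
  qed simp
  define m where "m = (SOME m. u \<in> S_upto (m + 1))"
  have "u \<in> S_upto (m + 1)"
    unfolding m_def by (rule someI) (rule assms)
  then have "schubert_at m u = schubert_at n u"
    using eq[of m n] eq[of n m] assms by (simp add: add.commute)
  then show ?thesis
    by (simp add: schubert_def m_def)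
qed

lemma S_inf_S_upto_ge:
  assumes "u \<in> S_inf"
  obtains n where "m \<le> n" "u \<in> S_upto (n + 1)"
proof -
  obtain N where "\<And>n. N \<le> n \<Longrightarrow> u \<in> S_upto n"
    using S_inf_S_upto[OF assms] by blast
  then show ?thesis
    using that[of "max m N"] by simp
qed

lemma schubert_id [simp]: "schubert id = 1"
proof -
  have "w0 0 = id"
    by (auto simp: w0_def fun_eq_iff)
  then show ?thesis
    using schubert_eq_schubert_at[of id 0] schubert_at_w0[of 0] w0_in_S_upto[of 0] schubert_w0_eq[of 0 0]
    by (simp add: dominant_poly_def)
qed

lemma ddiff_schubert:
  assumes u: "u \<in> S_inf" and i: "1 \<le> i"
  shows "ddiff i (schubert u) = (if u (Suc i) < u i then schubert (u \<circ> transpose i (Suc i)) else 0)"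
proof -
  obtain n where n: "i \<le> n" "u \<in> S_upto (n + 1)"
    using S_inf_S_upto_ge[OF u] by blast
  then have "u \<circ> transpose i (Suc i) \<in> S_upto (n + 1)"
    using i by (intro S_upto_transpose) auto
  then show ?thesis
    using n ddiff_schubert_at[OF n(2) i n(1)] by (simp add: schubert_eq_schubert_at)
qed

section \<open>Divided differences in the y variables\<close>

lemma div_diff_y_schubert_w0:
  assumes i: "1 \<le> i" "i \<le> n"
  shows "div_diff (VY i) (VY (Suc i)) (schubert_w0 n) = - ddiff (n + 1 - i) (schubert_w0 n)"
proof -
  \<comment> \<open>In the staircase, column i ends in row c = n + 1 - i. The factor x_c - y_i of
    this corner box is removed by the operator in x_c as well as by the one in y_i, with opposite
    signs.\<close>
  define c where "c = n + 1 - i"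
  define r where "r = (\<lambda>j. if j = c then i - 1 else n + 1 - j)"
  have c: "1 \<le> c" "c \<le> n" "n + 1 - c = i"
    using i by (auto simp: c_def)
  have w0: "schubert_w0 n = dominant_poly (n + 1) (\<lambda>j. n + 1 - j)"
    by (rule schubert_w0_eq) simp
  also have "\<dots> = (Var (VX c) - Var (VY (Suc (r c)))) * dominant_poly (n + 1) r"
    using c i by (intro dominant_poly_Suc) (auto simp: r_def)
  also have "Suc (r c) = i"
    using i by (simp add: r_def)
  finally have eq: "schubert_w0 n = (Var (VX c) - Var (VY i)) * dominant_poly (n + 1) r" .
  have "ddiff c (schubert_w0 n) = dominant_poly (n + 1) r"
    unfolding w0 using c i by (intro ddiff_dominant_poly) (auto simp: r_def)
  moreover have "swap_var (VY i) (VY (Suc i)) (dominant_poly (n + 1) r) = dominant_poly (n + 1) r"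
    using i by (intro swap_var_y_dominant_poly) (auto simp: r_def c_def)
  then have "div_diff (VY i) (VY (Suc i)) (schubert_w0 n) = - dominant_poly (n + 1) r"
    unfolding eq by (intro div_diff_Var_mult') auto
  ultimately show ?thesis
    by (simp add: c_def)
qed

lemma div_diff_y_ddiff:
  "div_diff (VY i) (VY (Suc i)) (ddiff j P) = ddiff j (div_diff (VY i) (VY (Suc i)) P)"
  unfolding ddiff_eq by (rule div_diff_commute) auto

lemma div_diff_y_ddiff_perm:
  assumes "u \<in> S_inf"
  shows "div_diff (VY i) (VY (Suc i)) (ddiff_perm u P) = ddiff_perm u (div_diff (VY i) (VY (Suc i)) P)"
proof -
  obtain ks where ks: "reduced_word u ks"
    using reduced_word_exists[OF assms] ..
  have "div_diff (VY i) (VY (Suc i)) (foldr ddiff ks P) = foldr ddiff ks (div_diff (VY i) (VY (Suc i)) P)"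
    by (induction ks) (auto simp: div_diff_y_ddiff)
  then show ?thesis
    by (simp add: ddiff_perm_reduced_word[OF ks])
qed

lemma ddiff_perm_uminus:
  assumes "u \<in> S_inf"
  shows "ddiff_perm u (- P) = - ddiff_perm u P"
proof -
  obtain ks where ks: "reduced_word u ks"
    using reduced_word_exists[OF assms] ..
  have "foldr ddiff ks (- P) = - foldr ddiff ks P"
    by (induction ks) (auto simp: ddiff_eq div_diff_uminus)
  then show ?thesis
    by (simp add: ddiff_perm_reduced_word[OF ks])
qed

text \<open>The operator passes to the top polynomial, turns there into minus a divided difference
  in x with index n + 1 - i, and is absorbed by the word from the right; w0 s_j = s_i w0 translates
  the index back.\<close>

lemma div_diff_y_schubert:
  assumes u: "u \<in> S_inf" and i: "1 \<le> i"
  shows "div_diff (VY i) (VY (Suc i)) (schubert u) =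
    (if inv u (Suc i) < inv u i then - schubert (transpose i (Suc i) \<circ> u) else 0)"
proof -
  obtain n where n: "i \<le> n" "u \<in> S_upto (n + 1)"
    using S_inf_S_upto_ge[OF u] by blast
  define j where "j = n + 1 - i"
  have j: "1 \<le> j" "w0 n j = Suc i" "w0 n (Suc j) = i"
    using i n by (auto simp: j_def w0_def)
  let ?x = "inv u \<circ> w0 n"
  have "transpose i (Suc i) \<circ> u \<in> S_upto (n + 1)"
    using i n by (intro S_upto_transpose) auto
  then have su: "schubert (transpose i (Suc i) \<circ> u) = ddiff_perm (inv (transpose i (Suc i) \<circ> u) \<circ> w0 n) (schubert_w0 n)"
    by (simp add: schubert_eq_schubert_at schubert_at_def)
  have "w0 n \<circ> transpose j (Suc j) = transpose i (Suc i) \<circ> w0 n"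
    using transpose_comp_eq[OF S_inf_bij[OF w0_in_S_inf], of i "Suc i" n] w0_w0[of n] j
    by (metis inv_w0 transpose_commute)
  then have x: "?x \<circ> transpose j (Suc j) = inv (transpose i (Suc i) \<circ> u) \<circ> w0 n"
    using u by (simp add: inv_adj_comp comp_assoc)
  have "div_diff (VY i) (VY (Suc i)) (schubert u) = - ddiff_perm ?x (ddiff j (schubert_w0 n))"
    using n i u div_diff_y_schubert_w0[OF i n(1)]
    by (simp add: schubert_eq_schubert_at schubert_at_def div_diff_y_ddiff_perm ddiff_perm_uminus j_def)
  also have "ddiff_perm ?x (ddiff j (schubert_w0 n)) =
      (if inv u (Suc i) < inv u i then schubert (transpose i (Suc i) \<circ> u) else 0)"
    using u j by (subst ddiff_perm_ddiff) (auto simp: su x simp del: o_apply, auto)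
  finally show ?thesis
    by simp
qed

text \<open>Absence of the \<open>z\<close> variables is expressed as invariance under this substitution.\<close>

definition kill_z :: "var \<Rightarrow> mpoly" where
  "kill_z v = (case v of VZ _ \<Rightarrow> 0 | _ \<Rightarrow> Var v)"

lemma kill_z_simps [simp]: "kill_z (VX i) = Var (VX i)" "kill_z (VY i) = Var (VY i)" "kill_z (VZ i) = 0"
  by (simp_all add: kill_z_def)

lemma subst_kill_z_schubert:
  assumes u: "u \<in> S_inf"
  shows "subst kill_z (schubert u) = schubert u"
proof -
  obtain n where n: "u \<in> S_upto (n + 1)"
    using S_inf_S_upto_ge[OF u] by blast
  let ?x = "inv u \<circ> w0 n"
  obtain ks where ks: "reduced_word ?x ks"
    using reduced_word_exists[of ?x] u by auto
  have "subst kill_z (ddiff i P) = ddiff i (subst kill_z P)" for i P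
    unfolding ddiff_eq by (rule div_diff_subst[symmetric]) (auto simp: kill_z_def transpose_def split: var.split)
  then have "subst kill_z (foldr ddiff ks P) = foldr ddiff ks (subst kill_z P)" for P
    by (induction ks) auto
  moreover have "subst kill_z (schubert_w0 n) = schubert_w0 n"
    unfolding schubert_w0_def subst_prod by (intro prod.cong) auto
  ultimately show ?thesis
    using n by (simp add: schubert_eq_schubert_at schubert_at_def ddiff_perm_reduced_word[OF ks])
qed

lemma subst_schubert_cong:
  assumes "u \<in> S_inf" "\<And>i. f (VX i) = g (VX i)" "\<And>i. f (VY i) = g (VY i)"
  shows "subst f (schubert u) = subst g (schubert u)"
proof -
  have "subst f (kill_z v) = subst g (kill_z v)" for v
    using assms by (cases v) auto
  then have "subst f (subst kill_z (schubert u)) = subst g (subst kill_z (schubert u))"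
    by (simp add: subst_subst)
  then show ?thesis
    using assms(1) by (simp add: subst_kill_z_schubert)
qed

section \<open>Chains of transpositions\<close>

lemma len_transpose_coverD:
  assumes u: "u \<in> S_inf" "1 \<le> a" "a < b" and len: "len (u \<circ> transpose a b) = Suc (len u)"
  shows "u a < u b" and "a < c \<Longrightarrow> c < b \<Longrightarrow> u c < u a \<or> u b < u c"
proof -
  have *: "u a < u b \<and> (\<forall>c. a < c \<longrightarrow> c < b \<longrightarrow> \<not> (u a < u c \<and> u c < u b))"
    using len_transpose_cover_iff[OF u] len by blast
  then show "u a < u b" ..
  assume c: "a < c" "c < b"
  then have "u c \<noteq> u a" "u c \<noteq> u b"
    using S_inf_eq_iff[OF u(1)] by auto
  then show "u c < u a \<or> u b < u c"
    using * c by (meson linorder_neqE_nat)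
qed

text \<open>\<open>k_chain k u A w\<close>: a chain witnessing \<open>u \<rightarrow>\<^sup>k w\<close> whose set of left positions is \<open>A\<close>.\<close>

inductive k_chain :: "nat \<Rightarrow> (nat \<Rightarrow> nat) \<Rightarrow> nat set \<Rightarrow> (nat \<Rightarrow> nat) \<Rightarrow> bool" for k u where
  start: "k_chain k u {} u"
| step: "k_chain k u A w \<Longrightarrow> a \<notin> A \<Longrightarrow> 1 \<le> a \<Longrightarrow> a \<le> k \<Longrightarrow> k < b \<Longrightarrow>
    len (w \<circ> transpose a b) = Suc (len w) \<Longrightarrow> k_chain k u (insert a A) (w \<circ> transpose a b)"

lemma k_chain_in_S_inf: "k_chain k u A w \<Longrightarrow> u \<in> S_inf \<Longrightarrow> w \<in> S_inf"
  by (induction rule: k_chain.induct) auto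

lemma k_chain_subset: "k_chain k u A w \<Longrightarrow> A \<subseteq> {1..k}"
  by (induction rule: k_chain.induct) auto

lemma k_chain_finite: "k_chain k u A w \<Longrightarrow> finite A"
  by (meson finite_atLeastAtMost finite_subset k_chain_subset)

lemma k_chain_len: "k_chain k u A w \<Longrightarrow> len w = len u + card A"
  by (induction rule: k_chain.induct) (auto dest: k_chain_finite simp del: o_apply)

text \<open>A left position is used at most once, and a cover increases its value. Hence the set
  \<open>A\<close> can be read off from the two ends of the chain.\<close>

lemma k_chain_left:
  assumes "k_chain k u A w" "u \<in> S_inf" "1 \<le> x" "x \<le> k"
  shows "(x \<notin> A \<longrightarrow> w x = u x) \<and> (x \<in> A \<longrightarrow> u x < w x)"
  using assms
proof (induction rule: k_chain.induct)
  case (step A w a b)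
  have "w a < w b"
    by (rule len_transpose_coverD(1)) (use step k_chain_in_S_inf in auto)
  then show ?case
    using step by (auto simp: transpose_def)
qed simp

lemma k_chain_set_eq:
  assumes "k_chain k u A w" "u \<in> S_inf"
  shows "A = {a \<in> {1..k}. u a \<noteq> w a}"
  using k_chain_left[OF assms] k_chain_subset[OF assms(1)] by fastforce

lemma pieri_rel_iff_k_chain: "pieri_rel k u w \<longleftrightarrow> (\<exists>A. k_chain k u A w)"
proof
  assume "pieri_rel k u w"
  then obtain ts where ts: "\<And>a b. (a, b) \<in> set ts \<Longrightarrow> 1 \<le> a \<and> a \<le> k \<and> k < b" "distinct (map fst ts)"
      "\<And>i. i \<in> {1..length ts} \<Longrightarrow> len (u \<circ> apply_transps (take i ts)) = len u + i"
      "w = u \<circ> apply_transps ts"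
    unfolding pieri_rel_def by blast
  have "k_chain k u (fst ` set (take i ts)) (u \<circ> apply_transps (take i ts))" if "i \<le> length ts" for i
    using that
  proof (induction i)
    case 0
    then show ?case
      using k_chain.start[of k u] by simp
  next
    case (Suc i)
    obtain a b where ab: "ts ! i = (a, b)"
      by fastforce
    have mem: "(a, b) \<in> set ts"
      using Suc.prems ab by (metis Suc_le_lessD nth_mem)
    have take: "take (Suc i) ts = take i ts @ [(a, b)]"
      using Suc.prems ab by (simp add: take_Suc_conv_app_nth)
    have "distinct (map fst (take (Suc i) ts))"
      using ts(2) by (metis distinct_take take_map)
    then have "a \<notin> fst ` set (take i ts)"
      unfolding take by auto
    moreover have eq: "u \<circ> apply_transps (take (Suc i) ts) = (u \<circ> apply_transps (take i ts)) \<circ> transpose a b"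
      by (simp add: take comp_assoc)
    \<comment> \<open>The length condition starts at index 1, so the first step has to be
      separated.\<close>
    moreover have "len (u \<circ> apply_transps (take (Suc i) ts)) = Suc (len (u \<circ> apply_transps (take i ts)))"
      using ts(3)[of "Suc i"] ts(3)[of i] Suc.prems by (cases "i = 0") auto
    moreover have "fst ` set (take (Suc i) ts) = insert a (fst ` set (take i ts))"
      by (auto simp: take)
    ultimately show ?case
      using k_chain.step[of k u _ _ a b] Suc.IH Suc.prems ts(1)[OF mem] by (simp del: o_apply)
  qed
  from this[of "length ts"] show "\<exists>A. k_chain k u A w"
    using ts(4) by auto
next
  assume "\<exists>A. k_chain k u A w"
  then obtain A where A: "k_chain k u A w" ..
  then have "\<exists>ts. fst ` set ts = A \<and> (\<forall>(a, b)\<in>set ts. 1 \<le> a \<and> a \<le> k \<and> k < b) \<and> distinct (map fst ts) \<and>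
      (\<forall>i\<in>{1..length ts}. len (u \<circ> apply_transps (take i ts)) = len u + i) \<and> w = u \<circ> apply_transps ts"
  proof (induction rule: k_chain.induct)
    case start
    show ?case
      by (rule exI[of _ "[]"]) auto
  next
    case (step A w a b)
    then obtain ts where ts: "fst ` set ts = A" "\<forall>(a, b)\<in>set ts. 1 \<le> a \<and> a \<le> k \<and> k < b" "distinct (map fst ts)"
        "\<forall>i\<in>{1..length ts}. len (u \<circ> apply_transps (take i ts)) = len u + i" "w = u \<circ> apply_transps ts"
      by blast
    have "card A = length ts"
      using ts(1,3) distinct_card[of "map fst ts"] by simp
    then have "len (u \<circ> apply_transps (ts @ [(a, b)])) = len u + Suc (length ts)"
      using k_chain_len[OF step(1)] step ts(5) by (simp add: comp_assoc)
    then have "\<forall>i\<in>{1..length (ts @ [(a, b)])}. len (u \<circ> apply_transps (take i (ts @ [(a, b)]))) = len u + i"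
      using ts(4) by (auto simp: le_Suc_eq simp del: apply_transps_append)
    then show ?case
      using ts step by (intro exI[of _ "ts @ [(a, b)]"]) (auto simp: comp_assoc simp del: o_apply)
  qed
  then obtain ts where ts: "fst ` set ts = A" "\<forall>(a, b)\<in>set ts. 1 \<le> a \<and> a \<le> k \<and> k < b" "distinct (map fst ts)"
      "\<forall>i\<in>{1..length ts}. len (u \<circ> apply_transps (take i ts)) = len u + i" "w = u \<circ> apply_transps ts"
    by blast
  have "length ts = card A"
    using ts(1,3) distinct_card[of "map fst ts"] by simp
  also have "card A \<le> k"
    using card_mono[OF _ k_chain_subset[OF A]] by simp
  finally show "pieri_rel k u w"
    using ts unfolding pieri_rel_def by blast
qed

lemma P_set_eq_image: "P_set k u w = u ` {a \<in> {1..k}. u a = w a}"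
  unfolding P_set_def image_def atLeastAtMost_iff mem_Collect_eq by blast

lemma P_set_k_chain:
  assumes "k_chain k u A w" "u \<in> S_inf"
  shows "P_set k u w = u ` ({1..k} - A)"
  unfolding P_set_eq_image by (subst k_chain_set_eq[OF assms]) (rule arg_cong[of _ _ "(`) u"], auto)

lemma pieri_rel_in_S_inf: "pieri_rel k u w \<Longrightarrow> u \<in> S_inf \<Longrightarrow> w \<in> S_inf"
  unfolding pieri_rel_iff_k_chain using k_chain_in_S_inf by blast

lemma pieri_rel_len:
  assumes "pieri_rel k u w" "u \<in> S_inf"
  shows "\<exists>l\<le>k. len_diff u w = int l \<and> card (P_set k u w) = k - l"
proof -
  obtain A where A: "k_chain k u A w"
    using assms by (auto simp: pieri_rel_iff_k_chain)
  have "card (P_set k u w) = card ({1..k} - A)"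
    unfolding P_set_k_chain[OF A assms(2)] using S_inf_eq_iff[OF assms(2)]
    by (intro card_image) (auto simp: inj_on_def)
  also have "\<dots> = k - card A"
    using k_chain_subset[OF A] k_chain_finite[OF A] by (simp add: card_Diff_subset)
  finally show ?thesis
    using k_chain_len[OF A] card_mono[OF _ k_chain_subset[OF A]]
    by (intro exI[of _ "card A"]) (auto simp: len_diff_def)
qed

subsection \<open>Right multiplication by a simple transposition\<close>

text \<open>As i and i + 1 lie on the same side of k, they are not both exchanged. If i = a, then i
  + 1 is strictly between a and b, so its value, being above w(a), is also above w(b); dually if i +
  1 = b.\<close>

lemma cover_preserves_ascent:
  assumes w: "w \<in> S_inf" and ab: "1 \<le> a" "a \<le> k" "k < b"
    and cover: "len (w \<circ> transpose a b) = Suc (len w)"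
    and i: "i \<noteq> k" "w i < w (Suc i)"
  shows "(w \<circ> transpose a b) i < (w \<circ> transpose a b) (Suc i)"
proof -
  have "w a < w b" and between: "a < c \<longrightarrow> c < b \<longrightarrow> w c < w a \<or> w b < w c" for c
    using len_transpose_coverD[OF w _ _ cover] ab by auto
  consider "i = a" | "Suc i = a" | "i = b" | "Suc i = b" "i \<noteq> a" | "i \<noteq> a" "Suc i \<noteq> a" "i \<noteq> b" "Suc i \<noteq> b"
    by blast
  then show ?thesis
  proof cases
    case 1
    then have "w b < w (Suc i)"
      using ab i between[of "Suc i"] by auto
    then show ?thesis
      using 1 ab i by (auto simp: transpose_def)
  next
    case 4
    then have "w i < w a"
      using ab i between[of i] by auto
    then show ?thesis
      using 4 ab by (auto simp: transpose_def)
  qed (use ab i \<open>w a < w b\<close> in \<open>auto simp: transpose_def\<close>)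
qed

lemma transpose_adj_conj:
  "w \<circ> transpose a b \<circ> transpose i (Suc i) =
    w \<circ> transpose i (Suc i) \<circ> transpose (transpose i (Suc i) a) (transpose i (Suc i) b)"
  by (auto simp: fun_eq_iff transpose_def)

lemma adj_le_iff: "i \<noteq> k \<Longrightarrow> transpose i (Suc i) a \<le> k \<longleftrightarrow> a \<le> k"
  by (auto simp: transpose_def)

lemma adj_ge_1_iff: "1 \<le> i \<Longrightarrow> 1 \<le> transpose i (Suc i) a \<longleftrightarrow> 1 \<le> a"
  by (auto simp: transpose_def)

lemma k_chain_step_conj:
  assumes "k_chain k (u \<circ> transpose i (Suc i)) (transpose i (Suc i) ` A) (w \<circ> transpose i (Suc i))"
    and "1 \<le> i" "i \<noteq> k" "a \<notin> A" "1 \<le> a" "a \<le> k" "k < b"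
    and "len (w \<circ> transpose a b \<circ> transpose i (Suc i)) = Suc (len (w \<circ> transpose i (Suc i)))"
  shows "k_chain k (u \<circ> transpose i (Suc i)) (transpose i (Suc i) ` insert a A)
    (w \<circ> transpose a b \<circ> transpose i (Suc i))"
proof -
  let ?s = "transpose i (Suc i)"
  have "?s a \<notin> ?s ` A"
    using assms(4) by (simp add: inj_image_mem_iff inj_transpose)
  moreover have "1 \<le> ?s a" "?s a \<le> k" "\<not> ?s b \<le> k"
    using assms(5-7) unfolding adj_ge_1_iff[OF assms(2)] adj_le_iff[OF assms(3)] by simp_all
  ultimately show ?thesis
    using k_chain.step[OF assms(1), of "?s a" "?s b"] assms(8)
    by (simp only: transpose_adj_conj image_insert not_le simp_thms)
qed

text \<open>The ascent persists along the chain, so s_i raises every length by one and covers remain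
  covers; conjugation by s_i respects the two sides of k.\<close>

lemma k_chain_comp_adj_asc:
  assumes "k_chain k u A w" "u \<in> S_inf" "1 \<le> i" "i \<noteq> k" "u i < u (Suc i)"
  shows "w i < w (Suc i) \<and>
    k_chain k (u \<circ> transpose i (Suc i)) (transpose i (Suc i) ` A) (w \<circ> transpose i (Suc i))"
  using assms
proof (induction rule: k_chain.induct)
  case start
  then show ?case
    using k_chain.start by simp
next
  case (step A w a b)
  let ?s = "transpose i (Suc i)" and ?t = "transpose a b"
  have w: "w \<in> S_inf"
    using step k_chain_in_S_inf by blast
  have asc: "w i < w (Suc i)"
    using step by blast
  have asc': "(w \<circ> ?t) i < (w \<circ> ?t) (Suc i)"
    by (rule cover_preserves_ascent[where k = k]) (use step w asc in auto)
  have "len (w \<circ> ?t \<circ> ?s) = Suc (len (w \<circ> ?s))"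
    using len_comp_adj_asc[OF w _ asc] len_comp_adj_asc[OF _ _ asc'] step w by (simp del: o_apply)
  then have "k_chain k (u \<circ> ?s) (?s ` insert a A) (w \<circ> ?t \<circ> ?s)"
    using step.IH step.prems step.hyps by (intro k_chain_step_conj) (auto simp del: o_apply)
  then show ?case
    using asc' by blast
qed

text \<open>Ascents persist, so a descent at the end of the chain forces one at every stage.\<close>

lemma k_chain_comp_adj_desc:
  assumes "k_chain k u A w" "u \<in> S_inf" "1 \<le> i" "i \<noteq> k" "w (Suc i) < w i"
  shows "k_chain k (u \<circ> transpose i (Suc i)) (transpose i (Suc i) ` A) (w \<circ> transpose i (Suc i))"
  using assms
proof (induction rule: k_chain.induct)
  case start
  then show ?case
    using k_chain.start by simp
next
  case (step A w a b)
  let ?s = "transpose i (Suc i)" and ?t = "transpose a b"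
  have w: "w \<in> S_inf"
    using step k_chain_in_S_inf by blast
  have "\<not> w i < w (Suc i)"
    using cover_preserves_ascent[OF w, of a k b i] step by auto
  then have desc: "w (Suc i) < w i"
    using S_inf_eq_iff[OF w, of i "Suc i"] by simp
  have "len (w \<circ> ?t \<circ> ?s) = Suc (len (w \<circ> ?s))"
    using len_comp_adj_desc[OF w _ desc] len_comp_adj_desc[of "w \<circ> ?t" i] step w by (simp del: o_apply)
  then have "k_chain k (u \<circ> ?s) (?s ` insert a A) (w \<circ> ?t \<circ> ?s)"
    using step.IH[OF step.prems(1-3) desc] step.prems step.hyps by (intro k_chain_step_conj) (auto simp del: o_apply)
  then show ?case .
qed

lemma P_set_comp_adj:
  assumes "i \<noteq> k" "1 \<le> i"
  shows "P_set k (u \<circ> transpose i (Suc i)) (w \<circ> transpose i (Suc i)) = P_set k u w"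
proof -
  have sub: "P_set k (u \<circ> transpose i (Suc i)) (w \<circ> transpose i (Suc i)) \<subseteq> P_set k u w" for u w :: "nat \<Rightarrow> nat"
    unfolding P_set_eq_image using adj_le_iff[OF assms(1)] adj_ge_1_iff[OF assms(2)]
    by (auto intro!: image_eqI[of _ u "transpose i (Suc i) _"])
  from sub[of u w] sub[of "u \<circ> transpose i (Suc i)" "w \<circ> transpose i (Suc i)"] show ?thesis
    by simp
qed

subsection \<open>Left multiplication by a simple transposition\<close>

text \<open>If the exchange reverses the order of i and i + 1 but moves only one of them, then the
  other stands strictly between a and b with a value between w(a) and w(b), which a cover
  excludes.\<close>

lemma cover_reversing_adjacent_values:
  assumes w: "w \<in> S_inf" and ab: "1 \<le> a" "a < b"
    and cover: "len (w \<circ> transpose a b) = Suc (len w)"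
    and asc: "inv w i < inv w (Suc i)"
    and desc: "inv (w \<circ> transpose a b) (Suc i) < inv (w \<circ> transpose a b) i"
  shows "w a = i \<and> w b = Suc i"
proof -
  define p q where "p = inv w i" and "q = inv w (Suc i)"
  have pq: "w p = i" "w q = Suc i" "p < q" "transpose a b q < transpose a b p"
    using w asc desc by (simp_all add: p_def q_def S_inf_inv_apply inv_comp_adj)
  have "w a < w b" and between: "a < c \<longrightarrow> c < b \<longrightarrow> w c < w a \<or> w b < w c" for c
    using len_transpose_coverD[OF w ab cover] by auto
  have ne: "w b = Suc i \<longleftrightarrow> b = q" "w a = i \<longleftrightarrow> a = p"
    using S_inf_eq_iff[OF w, of b q] S_inf_eq_iff[OF w, of a p] pq by auto
  have "a = p \<and> b = q"
    using pq ab ne \<open>w a < w b\<close> between[of p] between[of q]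
    by (cases "a = p"; cases "b = q"; cases "a = q"; cases "b = p") (auto simp: transpose_def split: if_splits)
  then show ?thesis
    using pq by simp
qed

text \<open>Here \<open>u\<close> is the longer permutation, for which the formula will be known,
  and \<open>v\<close> the one below it to which the formula is transferred.\<close>

context
  fixes k i p q :: nat and u v :: "nat \<Rightarrow> nat"
  assumes u: "u \<in> S_inf" and i: "1 \<le> i" and p: "1 \<le> p" "p \<le> k" "u p = Suc i" and q: "k < q" "u q = i"
    and v: "v = transpose i (Suc i) \<circ> u"
begin

lemma inv_pq: "inv u (Suc i) = p" "inv u i = q"
  using u p q by (metis S_inf_inv_apply(2))+

lemma v_in_S_inf: "v \<in> S_inf"
  using u i by (simp add: v)

lemma v_eq: "v = u \<circ> transpose p q"
  unfolding v using transpose_comp_eq[OF S_inf_bij[OF u], of i "Suc i"] by (simp add: inv_pq transpose_commute)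

lemma v_p: "v p = i" and v_q: "v q = Suc i"
  using p q by (simp_all add: v)

lemma v_left: "a \<le> k \<Longrightarrow> a \<noteq> p \<Longrightarrow> v a = u a"
  using q by (auto simp: v_eq transpose_def)

text \<open>The step from \<open>v\<close> up to \<open>u\<close> is a cover with left position
  \<open>p\<close>, so it may precede any chain that leaves \<open>p\<close> alone.\<close>

lemma k_chain_prepend:
  assumes "k_chain k u A w" "p \<notin> A"
  shows "k_chain k v (insert p A) w"
  using assms
proof (induction rule: k_chain.induct)
  case start
  have "len (v \<circ> transpose p q) = Suc (len v)"
    using len_adj_comp_desc[OF u i] p q by (simp add: inv_pq v_eq[symmetric] v[symmetric]) (simp add: v_eq)
  then have "k_chain k v {p} (v \<circ> transpose p q)"
    using p q by (intro k_chain.step k_chain.start) auto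
  then show ?case
    by (simp add: v_eq del: o_apply)
next
  case (step A w a b)
  then have "k_chain k v (insert a (insert p A)) (w \<circ> transpose a b)"
    by (intro k_chain.step) (auto simp del: o_apply)
  then show ?case
    by (simp add: insert_commute del: o_apply)
qed

text \<open>A step that brings i + 1 in front of i would need i at a left position not yet used, but
  in \<open>u\<close> the value i is at \<open>q\<close>, to the right of k. So the descent is
  present at every stage.\<close>

lemma k_chain_adj_comp_desc:
  assumes "k_chain k u A w" "inv w (Suc i) < inv w i"
  shows "k_chain k v A (transpose i (Suc i) \<circ> w)"
  using assms
proof (induction rule: k_chain.induct)
  case start
  then show ?case
    using k_chain.start[of k v] by (simp add: v del: o_apply)
next
  case (step A w a b)
  let ?s = "transpose i (Suc i)" and ?t = "transpose a b"
  have w: "w \<in> S_inf"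
    using step u k_chain_in_S_inf by blast
  have "\<not> inv w i < inv w (Suc i)"
  proof
    assume "inv w i < inv w (Suc i)"
    then have "w a = i"
      using cover_reversing_adjacent_values[OF w, of a b i] step by auto
    then have "u a = u q"
      using k_chain_left[OF step(1) u, of a] step q by auto
    then show False
      using S_inf_eq_iff[OF u] step q by auto
  qed
  then have desc: "inv w (Suc i) < inv w i"
    using S_inf_eq_iff[OF inv_in_S_inf[OF w], of i "Suc i"] by simp
  have "len (?s \<circ> w \<circ> ?t) = Suc (len (?s \<circ> w))"
    using len_adj_comp_desc[OF w i desc] len_adj_comp_desc[OF _ i step(8)] step w
    by (simp add: comp_assoc del: o_apply)
  then have "k_chain k v (insert a A) (?s \<circ> w \<circ> ?t)"
    using step desc by (intro k_chain.step) (auto simp del: o_apply)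
  then show ?case
    by (simp add: comp_assoc del: o_apply)
qed

text \<open>
  Follow a chain from \<open>v\<close>, with the values \<open>i\<close> and \<open>i + 1\<close> exchanged, as a chain from \<open>u\<close>.  This
  works until the chain exchanges \<open>i\<close> and \<open>i + 1\<close>, which is possible only at position \<open>p\<close>; from then
  on the chain itself, with this step omitted, is a chain from \<open>u\<close>.
\<close>

lemma k_chain_adj_comp_cases:
  assumes "k_chain k v A w"
  shows "inv w i < inv w (Suc i) \<and> k_chain k u A (transpose i (Suc i) \<circ> w) \<or>
    p \<in> A \<and> w p = Suc i \<and> k_chain k u (A - {p}) w"
  using assms
proof (induction rule: k_chain.induct)
  case start
  have "inv v = inv u \<circ> transpose i (Suc i)"
    unfolding v by (rule inv_adj_comp[OF u])
  moreover have "transpose i (Suc i) \<circ> v = u"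
    by (simp add: v)
  ultimately show ?case
    using p q k_chain.start[of k u] by (simp add: inv_pq)
next
  case (step A w a b)
  let ?s = "transpose i (Suc i)" and ?t = "transpose a b"
  have w: "w \<in> S_inf"
    using step v_in_S_inf k_chain_in_S_inf by blast
  have ab: "1 \<le> a" "a < b"
    using step by auto
  from step.IH show ?case
  proof (elim disjE conjE)
    assume asc: "inv w i < inv w (Suc i)" and chain: "k_chain k u A (?s \<circ> w)"
    show ?thesis
    proof (cases "inv (w \<circ> ?t) i < inv (w \<circ> ?t) (Suc i)")
      case True
      have "len (?s \<circ> w \<circ> ?t) = Suc (len (?s \<circ> w))"
        using len_adj_comp_asc[OF w i asc] len_adj_comp_asc[OF _ i True] step w
        by (simp add: comp_assoc del: o_apply)
      then have "k_chain k u (insert a A) (?s \<circ> w \<circ> ?t)"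
        using step chain by (intro k_chain.step) (auto simp del: o_apply)
      then show ?thesis
        using True by (simp add: comp_assoc del: o_apply)
    next
      case False
      then have "inv (w \<circ> ?t) (Suc i) < inv (w \<circ> ?t) i"
        using S_inf_eq_iff[OF inv_in_S_inf, of "w \<circ> ?t" i "Suc i"] w step by simp
      then have wab: "w a = i" "w b = Suc i"
        using cover_reversing_adjacent_values[OF w ab step(6) asc] by auto
      have "v a = v p"
        using k_chain_left[OF step(1) v_in_S_inf, of a] step wab by (simp add: v_p)
      then have "a = p"
        using S_inf_eq_iff[OF v_in_S_inf] by blast
      have "inv w i = a" "inv w (Suc i) = b"
        using wab w by (metis S_inf_inv_apply(2))+
      then have "?s \<circ> w = w \<circ> ?t"
        using transpose_comp_eq[OF S_inf_bij[OF w], of i "Suc i"] by simp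
      then have "k_chain k u (insert a A - {p}) (w \<circ> ?t)"
        using chain step \<open>a = p\<close> by simp
      moreover have "(w \<circ> ?t) p = Suc i"
        using \<open>a = p\<close> wab by simp
      ultimately show ?thesis
        using \<open>a = p\<close> by blast
    qed
  next
    assume *: "p \<in> A" "w p = Suc i" "k_chain k u (A - {p}) w"
    then have "k_chain k u (insert a (A - {p})) (w \<circ> ?t)"
      using step by (intro k_chain.step) (auto simp del: o_apply)
    moreover have "a \<noteq> p" "b \<noteq> p"
      using * step p by auto
    then have "insert a (A - {p}) = insert a A - {p}" "(w \<circ> ?t) p = Suc i"
      using * by auto
    ultimately show ?thesis
      using * by (metis insertI2)
  qed
qed

text \<open>The two parts are the supports of the two Leibniz terms: the divided difference acts on
  the coefficient in the first and on the Schubert polynomial in the second.\<close>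

lemma pieri_rel_adj_comp:
  "{w. pieri_rel k v w} = {w. pieri_rel k u w \<and> w p = Suc i} \<union>
    (\<lambda>w. transpose i (Suc i) \<circ> w) ` {w. pieri_rel k u w \<and> inv w (Suc i) < inv w i}" (is "?L = ?R1 \<union> ?R2")
proof (intro equalityI subsetI)
  fix w assume "w \<in> ?L"
  then obtain A where A: "k_chain k v A w"
    by (auto simp: pieri_rel_iff_k_chain)
  have w: "w \<in> S_inf"
    using A v_in_S_inf k_chain_in_S_inf by blast
  from k_chain_adj_comp_cases[OF A] show "w \<in> ?R1 \<union> ?R2"
  proof (elim disjE conjE)
    assume "inv w i < inv w (Suc i)" "k_chain k u A (transpose i (Suc i) \<circ> w)"
    then have "transpose i (Suc i) \<circ> w \<in> {w. pieri_rel k u w \<and> inv w (Suc i) < inv w i}"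
      using w by (auto simp: pieri_rel_iff_k_chain inv_adj_comp)
    then show ?thesis
      by (intro UnI2 image_eqI[of _ _ "transpose i (Suc i) \<circ> w"]) auto
  qed (auto simp: pieri_rel_iff_k_chain)
next
  fix w assume "w \<in> ?R1 \<union> ?R2"
  then show "w \<in> ?L"
  proof
    assume "w \<in> ?R1"
    then obtain A where A: "k_chain k u A w" "w p = Suc i"
      by (auto simp: pieri_rel_iff_k_chain)
    then have "p \<notin> A"
      using k_chain_left[OF A(1) u, of p] p by auto
    then show ?thesis
      using k_chain_prepend[OF A(1)] by (auto simp: pieri_rel_iff_k_chain)
  next
    assume "w \<in> ?R2"
    then show ?thesis
      using k_chain_adj_comp_desc by (auto simp: pieri_rel_iff_k_chain)
  qed
qed

text \<open>Along chains from \<open>u\<close> the value at \<open>p\<close> never drops below i +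
  1, so s_i cannot turn it into i + 1.\<close>

lemma pieri_rel_adj_comp_disjoint:
  "{w. pieri_rel k u w \<and> w p = Suc i} \<inter>
    (\<lambda>w. transpose i (Suc i) \<circ> w) ` {w. pieri_rel k u w \<and> inv w (Suc i) < inv w i} = {}"
proof -
  have False if w: "pieri_rel k u w" "transpose i (Suc i) (w p) = Suc i" for w
  proof -
    obtain A where "k_chain k u A w"
      using w by (auto simp: pieri_rel_iff_k_chain)
    then have "Suc i \<le> w p"
      using k_chain_left[of k u A w p] u p by auto
    then show False
      using w(2) by (auto simp: transpose_def split: if_splits)
  qed
  then show ?thesis
    by auto
qed

lemma P_set_adj_comp: "P_set k v (transpose i (Suc i) \<circ> w) = transpose i (Suc i) ` P_set k u w"
  by (simp add: P_set_eq_image v image_comp inj_eq[OF inj_transpose])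

text \<open>From \<open>u\<close> the value i + 1 at \<open>p\<close> is unmoved; from
  \<open>v\<close> the position \<open>p\<close> starts with i and does move. So passing to
  \<open>v\<close> deletes one factor of the coefficient, as the divided difference does.\<close>

lemma P_set_fixed:
  assumes "w p = Suc i"
  shows "P_set k u w = insert (Suc i) (P_set k v w)" "i \<notin> P_set k v w" "Suc i \<notin> P_set k v w"
proof -
  have eq: "{a \<in> {1..k}. u a = w a} = insert p {a \<in> {1..k}. v a = w a}"
    using assms p v_left v_p by (auto, metis)
  have img: "u ` {a \<in> {1..k}. v a = w a} = v ` {a \<in> {1..k}. v a = w a}"
  proof (rule image_cong)
    fix x assume "x \<in> {a \<in> {1..k}. v a = w a}"
    then show "u x = v x"
      using v_left[of x] v_p assms by (cases "x = p") auto
  qed simp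
  show "P_set k u w = insert (Suc i) (P_set k v w)"
    by (simp only: P_set_eq_image eq image_insert p(3) img)
  show "i \<notin> P_set k v w"
  proof
    assume "i \<in> P_set k v w"
    then obtain a where a: "v a = v p" "v a = w a"
      unfolding P_set_def v_p by fastforce
    then have "a = p"
      using S_inf_eq_iff[OF v_in_S_inf] by blast
    then show False
      using a assms v_p by simp
  qed
  show "Suc i \<notin> P_set k v w"
  proof
    assume "Suc i \<in> P_set k v w"
    then obtain a where a: "v a = v q" "a \<le> k"
      unfolding P_set_def v_q by fastforce
    then have "a = q"
      using S_inf_eq_iff[OF v_in_S_inf] by blast
    then show False
      using a q by simp
  qed
qed

text \<open>The coefficient is then symmetric in y_i and y_{i+1}, and its divided difference
  vanishes.\<close>

lemma P_set_moved:
  assumes "w p \<noteq> Suc i"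
  shows "i \<notin> P_set k u w" "Suc i \<notin> P_set k u w"
proof -
  show "i \<notin> P_set k u w"
  proof
    assume "i \<in> P_set k u w"
    then obtain a where a: "u a = u q" "a \<le> k"
      unfolding P_set_def q(2) by fastforce
    then have "a = q"
      using S_inf_eq_iff[OF u] by blast
    then show False
      using a q by simp
  qed
  show "Suc i \<notin> P_set k u w"
  proof
    assume "Suc i \<in> P_set k u w"
    then obtain a where a: "u a = u p" "u a = w a"
      unfolding P_set_def p(3) by fastforce
    then have "a = p"
      using S_inf_eq_iff[OF u] by blast
    then show False
      using a assms p by simp
  qed
qed

end

section \<open>The top factorial elementary symmetric polynomial\<close>

definition pieri_coeff :: "nat \<Rightarrow> (nat \<Rightarrow> nat) \<Rightarrow> (nat \<Rightarrow> nat) \<Rightarrow> mpoly" where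
  "pieri_coeff k u w = (\<Prod>c\<in>P_set k u w. Var (VY c) - Var (VZ 1))"

text \<open>This is E_{k,k}(x;z), but \<open>schubert_cyc_full\<close> derives that from the Pieri
  formula for this very product, so the product stands in until then.\<close>

definition top_factorial :: "nat \<Rightarrow> mpoly" where
  "top_factorial k = (\<Prod>i\<in>{1..k}. Var (VX i) - Var (VZ 1))"

definition top_pieri :: "nat \<Rightarrow> (nat \<Rightarrow> nat) \<Rightarrow> bool" where
  "top_pieri k u \<longleftrightarrow>
    schubert u * top_factorial k = (\<Sum>w | pieri_rel k u w. pieri_coeff k u w * schubert w)"

lemma swap_var_top_factorial:
  assumes "1 \<le> i" "i \<noteq> k"
  shows "swap_var (VX i) (VX (Suc i)) (top_factorial k) = top_factorial k"
proof -
  let ?s = "transpose i (Suc i)"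
  have VX: "transpose (VX i) (VX (Suc i)) (VX j) = VX (?s j)"
    and VZ: "transpose (VX i) (VX (Suc i)) (VZ j) = VZ j" for j
    by (auto simp: transpose_def)
  show ?thesis
    unfolding top_factorial_def swap_var_prod swap_var_simps VX VZ
    by (rule prod.reindex_bij_witness[of _ ?s ?s]) (use assms in \<open>auto simp: transpose_def\<close>)
qed

lemma swap_var_x_pieri_coeff: "swap_var (VX i) (VX j) (pieri_coeff k u w) = pieri_coeff k u w"
  unfolding pieri_coeff_def swap_var_prod by (intro prod.cong) (auto simp: transpose_def)

text \<open>Under \<open>ddiff i\<close> the terms with an ascent at i die; on the remaining ones w
  \<mapsto> w s_i is a bijection onto the indices for \<open>u\<close>, with unchanged
  coefficients.\<close>

lemma top_pieri_comp_adj: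
  assumes u: "u \<in> S_inf" and i: "1 \<le> i" "i \<noteq> k" "u i < u (Suc i)"
    and top: "top_pieri k (u \<circ> transpose i (Suc i))"
  shows "top_pieri k u"
proof -
  let ?s = "transpose i (Suc i)"
  let ?v = "u \<circ> ?s"
  have v: "?v \<in> S_inf"
    using u i by simp
  have "pieri_rel k u (w \<circ> ?s)" if "pieri_rel k ?v w" "w (Suc i) < w i" for w
    using that k_chain_comp_adj_desc[OF _ v i(1,2)] by (auto simp: pieri_rel_iff_k_chain comp_assoc)
  moreover have "pieri_rel k ?v (w \<circ> ?s) \<and> w i < w (Suc i)" if "pieri_rel k u w" for w
    using that k_chain_comp_adj_asc[OF _ u i] by (auto simp: pieri_rel_iff_k_chain simp del: o_apply)
  ultimately have bij: "(\<Sum>w | pieri_rel k ?v w \<and> w (Suc i) < w i. pieri_coeff k ?v w * schubert (w \<circ> ?s)) =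
      (\<Sum>w | pieri_rel k u w. pieri_coeff k u w * schubert w)"
    using i P_set_comp_adj[of i k ?v]
    by (intro sum.reindex_bij_witness[of _ "\<lambda>w. w \<circ> ?s" "\<lambda>w. w \<circ> ?s"])
      (auto simp: pieri_coeff_def comp_assoc)
  have "schubert u * top_factorial k = ddiff i (schubert ?v * top_factorial k)"
    using swap_var_top_factorial[OF i(1,2)] ddiff_schubert[OF v i(1)] i
    by (simp add: ddiff_eq div_diff_mult_symmetric mult.commute[of _ "top_factorial k"])
  also have "\<dots> = (\<Sum>w | pieri_rel k ?v w. pieri_coeff k ?v w * ddiff i (schubert w))"
    using top unfolding top_pieri_def
    by (simp add: ddiff_eq div_diff_sum div_diff_mult_symmetric swap_var_x_pieri_coeff del: o_apply)
  also have "\<dots> = (\<Sum>w | pieri_rel k ?v w. if w (Suc i) < w i then pieri_coeff k ?v w * schubert (w \<circ> ?s) else 0)"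
    using v i by (intro sum.cong) (auto simp: ddiff_schubert dest!: pieri_rel_in_S_inf)
  also have "\<dots> = (\<Sum>w | pieri_rel k ?v w \<and> w (Suc i) < w i. pieri_coeff k ?v w * schubert (w \<circ> ?s))"
    using finite_pieri_rel[OF v] by (simp add: sum.inter_filter[symmetric])
  finally show ?thesis
    unfolding top_pieri_def bij .
qed

lemma swap_var_y_prod:
  assumes "i \<notin> R" "j \<notin> R"
  shows "swap_var (VY i) (VY j) (\<Prod>c\<in>R. Var (VY c) - Var (VZ 1)) = (\<Prod>c\<in>R. Var (VY c) - Var (VZ 1))"
  unfolding swap_var_prod using assms by (intro prod.cong) (auto simp: transpose_def)

lemma div_diff_y_prod_insert:
  assumes "finite R" "i \<notin> R" "j \<notin> R" "i \<noteq> j"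
  shows "div_diff (VY i) (VY j) (\<Prod>c\<in>insert j R. Var (VY c) - Var (VZ 1)) = - (\<Prod>c\<in>R. Var (VY c) - Var (VZ 1))"
  using assms swap_var_y_prod[OF assms(2,3)]
  by (intro div_diff_eqI) (auto simp: algebra_simps transpose_def)

text \<open>Both Leibniz terms carry a minus sign, as does the left-hand side, and together they
  exhaust the indices for s_i u.\<close>

lemma top_pieri_adj_comp:
  assumes u: "u \<in> S_inf" and i: "1 \<le> i" and p: "1 \<le> p" "p \<le> k" "u p = Suc i" and q: "k < q" "u q = i"
    and top: "top_pieri k u"
  shows "top_pieri k (transpose i (Suc i) \<circ> u)"
proof -
  let ?s = "transpose i (Suc i)"
  define v where "v = ?s \<circ> u"
  let ?D = "div_diff (VY i) (VY (Suc i))" and ?S = "swap_var (VY i) (VY (Suc i))"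
  let ?W = "{w. pieri_rel k u w}"
  note facts = u i p q v_def
  have fin: "finite ?W" and fin': "finite (P_set k v w)" for w
    using finite_pieri_rel[OF u] by (auto simp: P_set_def)
  have "?S (top_factorial k) = top_factorial k"
    unfolding top_factorial_def swap_var_prod by (intro prod.cong) (auto simp: transpose_def)
  then have lhs: "?D (schubert u * top_factorial k) = - (schubert v * top_factorial k)"
    using div_diff_y_schubert[OF u i] p q inv_pq[OF facts]
    by (simp add: div_diff_mult_symmetric mult.commute[of _ "top_factorial k"] v_def)
  have D: "?D (pieri_coeff k u w) = (if w p = Suc i then - pieri_coeff k v w else 0)" for w
  proof (cases "w p = Suc i")
    case True
    then show ?thesis
      using div_diff_y_prod_insert[OF fin' P_set_fixed(2,3)[OF facts, of w, OF True]]
      unfolding pieri_coeff_def P_set_fixed(1)[OF facts, of w, OF True] by simp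
  next
    case False
    then show ?thesis
      using div_diff_symmetric[OF _ swap_var_y_prod[OF P_set_moved[OF facts, of w, OF False]]]
      unfolding pieri_coeff_def by simp
  qed
  have S: "?S (pieri_coeff k u w) = pieri_coeff k v (?s \<circ> w)" for w
  proof -
    have "transpose (VY i) (VY (Suc i)) (VY c) = VY (?s c)" "transpose (VY i) (VY (Suc i)) (VZ 1) = VZ 1" for c
      by (auto simp: transpose_def)
    then show ?thesis
      unfolding pieri_coeff_def swap_var_prod P_set_adj_comp[OF facts]
      by (subst prod.reindex) (auto simp: inj_transpose)
  qed
  have filter: "(\<Sum>w\<in>?W. if Q w then g w else 0) = (\<Sum>w | pieri_rel k u w \<and> Q w. g w)"
    for Q and g :: "(nat \<Rightarrow> nat) \<Rightarrow> mpoly"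
    using sum.inter_filter[OF fin, of g Q] by simp
  have "- (schubert v * top_factorial k) = (\<Sum>w\<in>?W. ?D (pieri_coeff k u w * schubert w))"
    using top unfolding lhs[symmetric] top_pieri_def by (simp add: div_diff_sum)
  also have "\<dots> = (\<Sum>w\<in>?W. - ((if w p = Suc i then pieri_coeff k v w * schubert w else 0) +
      (if inv w (Suc i) < inv w i then pieri_coeff k v (?s \<circ> w) * schubert (?s \<circ> w) else 0)))"
    using u i by (intro sum.cong)
      (auto simp: div_diff_Leibniz D S div_diff_y_schubert simp del: o_apply dest!: pieri_rel_in_S_inf)
  also have "\<dots> = - ((\<Sum>w | pieri_rel k u w \<and> w p = Suc i. pieri_coeff k v w * schubert w) +
      (\<Sum>w | pieri_rel k u w \<and> inv w (Suc i) < inv w i. pieri_coeff k v (?s \<circ> w) * schubert (?s \<circ> w)))"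
    by (simp only: sum_negf sum.distrib filter)
  also have "(\<Sum>w | pieri_rel k u w \<and> inv w (Suc i) < inv w i. pieri_coeff k v (?s \<circ> w) * schubert (?s \<circ> w)) =
      (\<Sum>w\<in>(\<lambda>w. ?s \<circ> w) ` {w. pieri_rel k u w \<and> inv w (Suc i) < inv w i}. pieri_coeff k v w * schubert w)"
    by (subst sum.reindex) (auto intro!: inj_onI dest: arg_cong[where f = "\<lambda>w. ?s \<circ> w"])
  also have "(\<Sum>w | pieri_rel k u w \<and> w p = Suc i. pieri_coeff k v w * schubert w) + \<dots> =
      (\<Sum>w | pieri_rel k v w. pieri_coeff k v w * schubert w)"
    unfolding pieri_rel_adj_comp[OF facts] using fin
    by (intro sum.union_disjoint[symmetric] pieri_rel_adj_comp_disjoint[OF facts]) auto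
  finally show ?thesis
    unfolding top_pieri_def v_def by (simp del: o_apply)
qed

section \<open>Chains from the longest element\<close>

lemma w0_plus_insert:
  assumes "\<And>x. x \<in> A \<Longrightarrow> x < a" "1 \<le> a" "a \<le> n + 1"
  shows "w0_plus n A \<circ> transpose a (n + 2) = w0_plus n (insert a A)"
proof
  fix i
  have "a \<notin> A" "n + 2 \<notin> A"
    using assms by force+
  have "{x \<in> A. x < n + 2} = {x \<in> A. x < a}"
    using assms by force
  then have "pred_in A (n + 2) = pred_in A a"
    unfolding pred_in_def by simp
  moreover have "pred_in (insert a A) a = pred_in A a"
    by (rule pred_in_cong) auto
  moreover have "pred_in (insert a A) (n + 2) = a"
    using assms by (intro pred_in_eqI) force+
  moreover have "pred_in (insert a A) i = pred_in A i" if "i \<in> A"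
    using assms(1)[OF that] by (intro pred_in_cong) auto
  ultimately show "(w0_plus n A \<circ> transpose a (n + 2)) i = w0_plus n (insert a A) i"
    using \<open>a \<notin> A\<close> \<open>n + 2 \<notin> A\<close> assms
    by (cases "i = a"; cases "i = n + 2") (auto simp: w0_plus_def w0_def)
qed

text \<open>Every exchange is forced to be with position n + 2, and the left positions must come in
  increasing order, so \<open>A\<close> alone determines \<open>w\<close>.\<close>

lemma k_chain_w0_imp:
  assumes "k_chain k (w0 n) A w" "k \<le> n + 1"
  shows "w = w0_plus n A"
  using assms
proof (induction rule: k_chain.induct)
  case start
  show ?case
    by (simp add: w0_plus_empty)
next
  case (step A w a b)
  have w: "w = w0_plus n A"
    using step by blast
  have wS: "w \<in> S_inf"
    using step k_chain_in_S_inf by force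
  have A: "A \<subseteq> {1..k}"
    using step k_chain_subset by blast
  have ab: "1 \<le> a" "a < b"
    using step by auto
  note cover = len_transpose_coverD[OF wS ab step(6)]
  have wa: "w a = n + 2 - a"
    using step by (auto simp: w w0_plus_def w0_def)
  have b: "n + 2 \<le> b"
  proof (rule ccontr)
    assume "\<not> n + 2 \<le> b"
    then have "w b = n + 2 - b"
      using step A by (auto simp: w w0_plus_def w0_def)
    then show False
      using cover(1) wa ab by simp
  qed
  have wb: "w b = (if b = n + 2 then n + 2 - pred_in A (n + 2) else b)"
    using b A step by (auto simp: w w0_plus_def w0_def)
  have top: "x < a" if "x \<in> A" for x
  proof (rule ccontr)
    assume "\<not> x < a"
    let ?B = "{x \<in> A. a < x}"
    \<comment> \<open>The next element of A after a. Its predecessor is below a, so w(a) < w(m)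
      \<le> n + 2. If b > n + 2, this value lies between w(a) and w(b) = b; if b = n + 2, then w(b)
      \<le> n + 2 - m < w(a).\<close>
    define m where "m = Min ?B"
    have B: "finite ?B" "?B \<noteq> {}"
      using \<open>\<not> x < a\<close> that step k_chain_finite by (auto simp: not_less le_less)
    then have m: "m \<in> A" "a < m"
      using Min_in[OF B] by (auto simp: m_def)
    have "m \<le> k"
      using m A by auto
    have "pred_in A m < a"
    proof (rule ccontr)
      assume "\<not> pred_in A m < a"
      then have "pred_in A m \<in> ?B" "pred_in A m < m"
        using pred_in_cases[of A m] ab step by (auto simp: not_less le_less)
      then show False
        using Min_le[OF B(1), of "pred_in A m"] by (auto simp: m_def)
    qed
    moreover have "w m = n + 2 - pred_in A m"
      using m by (simp add: w w0_plus_def)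
    ultimately have "w a < w m" "w m \<le> n + 2"
      using wa step by auto
    moreover have "m \<le> pred_in A (n + 2)"
      using m \<open>m \<le> k\<close> step by (intro pred_in_ge) auto
    ultimately show False
      using cover(1) cover(2)[of m] wa wb m b \<open>m \<le> k\<close> step by (auto split: if_splits)
  qed
  \<comment> \<open>For larger b, the value at position n + 2 would lie between w(a) and w(b) =
    b.\<close>
  have "b = n + 2"
  proof (rule ccontr)
    assume "b \<noteq> n + 2"
    have "pred_in A (n + 2) < a"
      using pred_in_cases[of A "n + 2"] top ab by auto
    moreover have "w (n + 2) = n + 2 - pred_in A (n + 2)"
      by (simp add: w w0_plus_def)
    ultimately show False
      using cover(2)[of "n + 2"] wa wb b \<open>b \<noteq> n + 2\<close> step by auto
  qed
  then show ?case
    unfolding w using w0_plus_insert[of A a n] top step by simp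
qed

text \<open>The elements of \<open>A\<close> are exchanged with n + 2 in increasing order, so to the
  right of the new position a all values before n + 2 are still the decreasing ones of
  \<open>w0 n\<close>.\<close>

lemma k_chain_w0_plus:
  assumes "A \<subseteq> {1..k}" "k \<le> n + 1"
  shows "k_chain k (w0 n) A (w0_plus n A)"
  using finite_subset[OF assms(1) finite_atLeastAtMost] assms
proof (induction rule: finite_linorder_max_induct)
  case empty
  show ?case
    using k_chain.start by (simp add: w0_plus_empty)
next
  case (insert a A)
  let ?w = "w0_plus n A"
  have chain: "k_chain k (w0 n) A ?w"
    using insert by auto
  then have w: "?w \<in> S_inf"
    using k_chain_in_S_inf by simp
  have "a \<notin> A"
    using insert by auto
  have wc: "?w c = n + 2 - c" if "a \<le> c" "c < n + 2" for c
    using that insert by (force simp: w0_plus_def w0_def)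
  have "pred_in A (n + 2) < a"
    using pred_in_cases[of A "n + 2"] insert by auto
  moreover have "?w (n + 2) = n + 2 - pred_in A (n + 2)"
    by (simp add: w0_plus_def)
  ultimately have "?w a < ?w (n + 2)"
    using wc[of a] insert by auto
  then have "len (?w \<circ> transpose a (n + 2)) = Suc (len ?w)"
    using insert wc[of a] wc by (intro len_transpose_Suc[OF w]) auto
  then have "k_chain k (w0 n) (insert a A) (?w \<circ> transpose a (n + 2))"
    using insert chain \<open>a \<notin> A\<close> by (intro k_chain.step) (auto simp del: o_apply)
  then show ?case
    using w0_plus_insert[of A a n] insert by (simp del: o_apply)
qed

lemma schubert_w0: "schubert (w0 n) = schubert_w0 n"
  using schubert_eq_schubert_at[OF w0_in_S_upto] by simp

lemma schubert_w0_plus: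
  assumes "A \<subseteq> {1..n + 1}"
  shows "schubert (w0_plus n A) = schubert_w0 n * (\<Prod>i\<in>A. Var (VX i) - Var (VY (n + 2 - i)))"
  using schubert_at_w0_plus_aux[OF assms] schubert_at_w0_plus[OF assms] schubert_eq_schubert_at[of "w0_plus n A" "n + 1"]
  by simp

lemma top_pieri_w0:
  assumes "k \<le> n + 1"
  shows "top_pieri k (w0 n)"
proof -
  have P: "pieri_coeff k (w0 n) (w0_plus n A) = (\<Prod>i\<in>{1..k} - A. Var (VY (n + 2 - i)) - Var (VZ 1))"
    if "A \<subseteq> {1..k}" for A
  proof -
    have "w0 n i = n + 2 - i" if "i \<in> {1..k} - A" for i
      using that assms by (auto simp: w0_def)
    then have "P_set k (w0 n) (w0_plus n A) = (\<lambda>i. n + 2 - i) ` ({1..k} - A)"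
      unfolding P_set_k_chain[OF k_chain_w0_plus[OF that assms] w0_in_S_inf] by (intro image_cong) auto
    moreover have "inj_on (\<lambda>i. n + 2 - i) ({1..k} - A)"
      using assms by (auto intro!: inj_onI)
    ultimately show ?thesis
      unfolding pieri_coeff_def by (simp add: prod.reindex)
  qed
  have "{w. pieri_rel k (w0 n) w} = w0_plus n ` Pow {1..k}"
  proof (intro equalityI subsetI)
    fix w assume "w \<in> {w. pieri_rel k (w0 n) w}"
    then obtain A where "k_chain k (w0 n) A w"
      by (auto simp: pieri_rel_iff_k_chain)
    then show "w \<in> w0_plus n ` Pow {1..k}"
      using k_chain_w0_imp[OF _ assms] k_chain_subset by (intro image_eqI[of _ _ A]) auto
  next
    fix w assume "w \<in> w0_plus n ` Pow {1..k}"
    then show "w \<in> {w. pieri_rel k (w0 n) w}"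
      using k_chain_w0_plus[OF _ assms] by (auto simp: pieri_rel_iff_k_chain)
  qed
  moreover have "inj_on (w0_plus n) (Pow {1..k})"
  proof (rule inj_onI)
    fix A B assume "A \<in> Pow {1..k}" "B \<in> Pow {1..k}" "w0_plus n A = w0_plus n B"
    then show "A = B"
      using k_chain_set_eq[OF k_chain_w0_plus[OF _ assms] w0_in_S_inf, of A]
        k_chain_set_eq[OF k_chain_w0_plus[OF _ assms] w0_in_S_inf, of B] by auto
  qed
  ultimately have "(\<Sum>w | pieri_rel k (w0 n) w. pieri_coeff k (w0 n) w * schubert w) =
      (\<Sum>A\<in>Pow {1..k}. pieri_coeff k (w0 n) (w0_plus n A) * schubert (w0_plus n A))"
    by (simp add: sum.reindex)
  also have "\<dots> = (\<Sum>A\<in>Pow {1..k}. schubert_w0 n * ((\<Prod>i\<in>A. Var (VX i) - Var (VY (n + 2 - i))) *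
      (\<Prod>i\<in>{1..k} - A. Var (VY (n + 2 - i)) - Var (VZ 1))))"
  proof (rule sum.cong[OF refl])
    fix A assume "A \<in> Pow {1..k}"
    then have "A \<subseteq> {1..k}" "A \<subseteq> {1..n + 1}"
      using assms by auto
    then show "pieri_coeff k (w0 n) (w0_plus n A) * schubert (w0_plus n A) = schubert_w0 n *
        ((\<Prod>i\<in>A. Var (VX i) - Var (VY (n + 2 - i))) * (\<Prod>i\<in>{1..k} - A. Var (VY (n + 2 - i)) - Var (VZ 1)))"
      by (simp add: P schubert_w0_plus algebra_simps)
  qed
  also have "\<dots> = schubert_w0 n * (\<Prod>i\<in>{1..k}. (Var (VX i) - Var (VY (n + 2 - i))) + (Var (VY (n + 2 - i)) - Var (VZ 1)))"
    by (subst prod_add) (simp_all add: sum_distrib_left)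
  finally show ?thesis
    unfolding top_pieri_def top_factorial_def schubert_w0 by simp
qed

lemma crossing_exists:
  fixes f :: "nat \<Rightarrow> nat"
  assumes "m < n" "f m \<le> k" "k < f n"
  shows "\<exists>j. m \<le> j \<and> j < n \<and> f j \<le> k \<and> k < f (Suc j)"
proof (rule ccontr)
  assume none: "\<not> ?thesis"
  have "m + d \<le> n \<Longrightarrow> f (m + d) \<le> k" for d
  proof (induction d)
    case (Suc d)
    then have "f (m + d) \<le> k"
      by simp
    then have "\<not> k < f (Suc (m + d))"
      using none Suc.prems by (metis Suc_le_eq add_Suc_right le_add1)
    then show ?case
      by simp
  qed (use assms in simp)
  from this[of "n - m"] show False
    using assms by simp
qed

lemma top_pieri:
  assumes "u \<in> S_inf"
  shows "top_pieri k u"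
proof -
  obtain n where n: "k \<le> n" "u \<in> S_upto (n + 1)"
    using S_inf_S_upto_ge[OF assms] by blast
  from n(2) show ?thesis
  proof (induction rule: S_upto_descending_induct)
    case w0
    show ?case
      using n by (intro top_pieri_w0) simp
  next
    case (asc u i)
    have u: "u \<in> S_inf"
      using asc(1) by (rule S_upto_imp_S_inf)
    show ?case
    proof (cases "i = k")
      case False
      have "u \<circ> transpose i (Suc i) \<in> S_upto (n + 1)"
        using asc by (intro S_upto_transpose) auto
      then have "top_pieri k (u \<circ> transpose i (Suc i))"
        using len_comp_adj_asc[OF u] asc by (intro asc.IH) (auto simp del: o_apply)
      then show ?thesis
        using top_pieri_comp_adj[OF u _ False] asc by blast
    next
      case True
      \<comment> \<open>Between the values u(k) and u(k+1) the position passes from k to k + 1, so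
        it crosses k at some consecutive j, j + 1. Both lie in {1..n+1}, which keeps s_j u in
        S_{n+1}.\<close>
      obtain j where j: "u k \<le> j" "j < u (Suc k)" "inv u j \<le> k" "k < inv u (Suc j)"
        using crossing_exists[of "u k" "u (Suc k)" "inv u" k] asc True u by (auto simp: S_inf_inv_apply)
      have "1 \<le> u k"
        using S_inf_pos[OF u, of k] asc True by simp
      have "u (Suc k) \<in> {1..n + 1}"
        using permutes_in_image[of u "{1..n + 1}" "Suc k"] asc True by (simp add: S_upto_iff_permutes)
      then have jn: "1 \<le> j" "j \<in> {1..n + 1}" "Suc j \<in> {1..n + 1}"
        using j \<open>1 \<le> u k\<close> by auto
      let ?v = "transpose j (Suc j) \<circ> u"
      have "?v \<in> S_upto (n + 1)"
        using asc jn by (intro S_upto_transpose)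
      moreover have "len u < len ?v"
        using len_adj_comp_asc[OF u jn(1)] j by simp
      ultimately have "top_pieri k ?v"
        by (rule asc.IH)
      \<comment> \<open>The longer \<open>?v\<close> has j + 1 where \<open>u\<close> has j, and
        conversely; s_j applied to it gives back \<open>u\<close>.\<close>
      then have "top_pieri k (transpose j (Suc j) \<circ> ?v)"
        using u jn j S_inf_inv_pos[OF u jn(1)]
        by (intro top_pieri_adj_comp[where u = "?v" and i = j and p = "inv u j" and q = "inv u (Suc j)"])
          (auto simp: S_inf_inv_apply)
      then show ?thesis
        by (simp del: o_apply)
    qed
  qed
qed

section \<open>Factorial elementary symmetric polynomials\<close>

lemma apply_adj_transps_upt:
  assumes "1 \<le> j" "j \<le> Suc k"
  shows "apply_adj_transps [j..<Suc k] i = (if j \<le> i \<and> i \<le> k then Suc i else if i = Suc k then j else i)"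
  using assms(2,1)
proof (induction j rule: inc_induct)
  case base
  then show ?case
    by simp
next
  case (step j)
  then show ?case
    by (subst upt_conv_Cons) (auto simp: transpose_def simp del: upt_Suc)
qed

lemma cyc_apply:
  assumes "p \<le> k"
  shows "cyc p k i = (if k + 1 - p \<le> i \<and> i \<le> k then Suc i else if i = Suc k then k + 1 - p else i)"
  unfolding cyc_def using apply_adj_transps_upt[of "k + 1 - p" k i] assms by (simp del: upt_Suc)

lemma cyc_in_S_inf: "p \<le> k \<Longrightarrow> cyc p k \<in> S_inf"
  unfolding cyc_def by (rule apply_adj_transps_in_S_inf) auto

lemma cyc_0: "cyc 0 k = id"
  by (simp add: cyc_def)

lemma cyc_Suc:
  assumes "p < k"
  shows "cyc (Suc p) k = transpose (k - p) (Suc (k - p)) \<circ> cyc p k"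
proof -
  have "[k + 1 - Suc p..<k + 1] = (k - p) # [k + 1 - p..<k + 1]"
    using assms by (simp add: upt_conv_Cons Suc_diff_le del: upt_Suc)
  then show ?thesis
    unfolding cyc_def by (simp del: upt_Suc add: fun_eq_iff)
qed

text \<open>Each exchange is with k + 1, and the left positions are k, k - 1, and so on: skipping
  the next one would leave an intermediate value between the two exchanged positions.\<close>

lemma k_chain_id:
  assumes "k_chain k id A w"
  shows "\<exists>p\<le>k. A = {k + 1 - p..k} \<and> w = cyc p k"
  using assms
proof (induction rule: k_chain.induct)
  case start
  show ?case
    by (rule exI[of _ 0]) (simp add: cyc_0)
next
  case (step A w a b)
  then obtain p where p: "p \<le> k" "A = {k + 1 - p..k}" "w = cyc p k"
    by blast
  have w: "w \<in> S_inf"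
    using cyc_in_S_inf p by simp
  have ab: "1 \<le> a" "a < b"
    using step by auto
  have a: "a \<le> k - p" "p < k"
    using step p by auto
  note cover = len_transpose_coverD[OF w ab step(6)]
  have vals: "w a = a" "w (Suc k) = k + 1 - p" "w b = (if b = Suc k then k + 1 - p else b)"
    using a p step by (auto simp: cyc_apply)
  have b: "b = Suc k"
    using cover(2)[of "Suc k"] vals step a by (cases "b = Suc k") auto
  have "a = k - p"
  proof (rule ccontr)
    assume "a \<noteq> k - p"
    then have "w (k - p) < w a \<or> w b < w (k - p)"
      using cover(2)[of "k - p"] a b by simp
    moreover have "w (k - p) = k - p"
      using a p by (auto simp: cyc_apply)
    ultimately show False
      using vals a b by auto
  qed
  have "cyc p k \<circ> transpose a b = cyc (Suc p) k"
    using p a \<open>a = k - p\<close> \<open>b = Suc k\<close> by (auto simp: fun_eq_iff cyc_apply transpose_def)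
  moreover have "insert a A = {k + 1 - Suc p..k}"
    using p a \<open>a = k - p\<close> by auto
  ultimately show ?case
    using p a by (intro exI[of _ "Suc p"]) auto
qed

lemma k_chain_cyc:
  assumes "p \<le> k"
  shows "k_chain k id {k + 1 - p..k} (cyc p k)"
  using assms
proof (induction p)
  case 0
  then show ?case
    using k_chain.start[of k id] by (simp add: cyc_0 id_def)
next
  case (Suc p)
  then have w: "cyc p k \<in> S_inf"
    using cyc_in_S_inf by simp
  have "len (cyc p k \<circ> transpose (k - p) (Suc k)) = Suc (len (cyc p k))"
    using Suc by (intro len_transpose_Suc[OF w]) (auto simp: cyc_apply)
  then have "k_chain k id (insert (k - p) {k + 1 - p..k}) (cyc p k \<circ> transpose (k - p) (Suc k))"
    using Suc by (intro k_chain.step) (auto simp del: o_apply id_apply)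
  moreover have "cyc p k \<circ> transpose (k - p) (Suc k) = cyc (Suc p) k"
    using Suc by (auto simp: fun_eq_iff cyc_apply transpose_def)
  moreover have "insert (k - p) {k + 1 - p..k} = {k + 1 - Suc p..k}"
    using Suc by auto
  ultimately show ?case
    by (simp del: id_apply)
qed

text \<open>
  In the case \<open>u = 1\<close> of the Pieri formula for \<open>p = k\<close>, the specialisation \<open>z\<^sub>1 = y\<^sub>1\<close> kills all terms
  except the one of \<open>c\<^sub>k\<^sub>k\<close>.
\<close>

lemma schubert_cyc_full: "schubert (cyc k k) = (\<Prod>i\<in>{1..k}. Var (VX i) - Var (VY 1))"
proof -
  define f where "f = (\<lambda>v. if v = VZ 1 then Var (VY 1) else Var v)"
  have f: "subst f (pieri_coeff k id w) = (\<Prod>c\<in>P_set k id w. Var (VY c) - Var (VY 1))" for w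
    by (simp add: pieri_coeff_def f_def)
  have schubert: "subst f (schubert w) = schubert w" if "w \<in> S_inf" for w
    using subst_schubert_cong[OF that, of f Var] by (simp add: f_def subst_Var)
  have zero: "subst f (pieri_coeff k id w) = 0" if w: "pieri_rel k id w" "w \<noteq> cyc k k" for w
  proof -
    obtain A p where A: "k_chain k id A w" "p \<le> k" "A = {k + 1 - p..k}" "w = cyc p k"
      using w k_chain_id by (metis pieri_rel_iff_k_chain)
    then have "p < k"
      using w by (cases "p = k") auto
    then have "1 \<in> P_set k id w"
      unfolding P_set_k_chain[OF A(1) id_in_S_inf] using A by auto
    moreover have "finite (P_set k id w)"
      by (simp add: P_set_def)
    ultimately show ?thesis
      unfolding f by (intro prod_zero) auto
  qed
  have cyc: "pieri_rel k id (cyc k k)"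
    using k_chain_cyc[of k k] pieri_rel_iff_k_chain by blast
  have "P_set k id (cyc k k) = {}"
    using P_set_k_chain[OF k_chain_cyc[of k k] id_in_S_inf] by simp
  then have one: "subst f (pieri_coeff k id (cyc k k)) = 1"
    unfolding f by simp
  have "top_factorial k = (\<Sum>w | pieri_rel k id w. pieri_coeff k id w * schubert w)"
    using top_pieri[of id k] by (simp add: top_pieri_def)
  then have "subst f (top_factorial k) = (\<Sum>w | pieri_rel k id w. subst f (pieri_coeff k id w) * schubert w)"
    using schubert by (auto intro!: sum.cong dest: pieri_rel_in_S_inf)
  also have "\<dots> = (\<Sum>w\<in>{cyc k k}. subst f (pieri_coeff k id w) * schubert w)"
    using finite_pieri_rel[OF id_in_S_inf] cyc zero by (intro sum.mono_neutral_right) auto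
  also have "subst f (top_factorial k) = (\<Prod>i\<in>{1..k}. Var (VX i) - Var (VY 1))"
    by (simp add: top_factorial_def f_def)
  finally show ?thesis
    by (simp add: one del: id_apply)
qed

text \<open>On Schubert polynomials this agrees with the substitution in \<open>schubert_xz\<close>.
  Sending the z variables to 0 makes their images symmetric, as \<open>div_diff_subst\<close>
  requires; leaving them in place would not.\<close>

definition y_to_z :: "var \<Rightarrow> mpoly" where
  "y_to_z v = (case v of VX i \<Rightarrow> Var (VX i) | VY j \<Rightarrow> Var (VZ j) | VZ j \<Rightarrow> 0)"

lemma y_to_z_simps [simp]: "y_to_z (VX i) = Var (VX i)" "y_to_z (VY i) = Var (VZ i)" "y_to_z (VZ i) = 0"
  by (simp_all add: y_to_z_def)

lemma schubert_xz_eq: "u \<in> S_inf \<Longrightarrow> schubert_xz u = subst y_to_z (schubert u)"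
  unfolding schubert_xz_def by (rule subst_schubert_cong) simp_all

section \<open>Divided differences in the z variables\<close>

lemma div_diff_z_schubert_xz:
  assumes "u \<in> S_inf" "1 \<le> i"
  shows "div_diff (VZ i) (VZ (Suc i)) (schubert_xz u) =
    (if inv u (Suc i) < inv u i then - schubert_xz (transpose i (Suc i) \<circ> u) else 0)"
proof -
  have "div_diff (VZ i) (VZ (Suc i)) (subst y_to_z (schubert u)) =
      subst y_to_z (div_diff (VY i) (VY (Suc i)) (schubert u))"
    by (rule div_diff_subst) (auto simp: y_to_z_def transpose_def split: var.split)
  then show ?thesis
    using assms by (simp add: schubert_xz_eq div_diff_y_schubert)
qed

lemma fact_elem_full: "fact_elem (int k) k = top_factorial k"
  by (simp add: fact_elem_def schubert_xz_eq cyc_in_S_inf schubert_cyc_full top_factorial_def)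

text \<open>The first letter of the word for c_{q+1,m} is m - q = d, and the operator removes it.
  Negative \<open>q\<close> is included because p - l can be negative: for q = -1 the constant 1
  goes to 0.\<close>

lemma div_diff_z_fact_elem:
  assumes "1 \<le> d" "int m - q = int d"
  shows "div_diff (VZ d) (VZ (Suc d)) (fact_elem (q + 1) m) = - fact_elem q m"
proof -
  consider (neg) "q < - 1" | (zero) "q = - 1" | (pos) "0 \<le> q"
    by linarith
  then show ?thesis
  proof cases
    case neg
    then show ?thesis
      by (simp add: fact_elem_def)
  next
    case zero
    then have "fact_elem (q + 1) m = 1"
      by (simp add: fact_elem_def schubert_xz_eq cyc_in_S_inf cyc_0)
    then show ?thesis
      using zero by (simp add: fact_elem_def div_diff_symmetric)
  next
    case pos
    define p where "p = nat q"
    have p: "q = int p" "p < m" "m - p = d"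
      using assms pos by (auto simp: p_def)
    let ?c = "cyc p m"
    have c: "?c \<in> S_inf"
      using p cyc_in_S_inf by simp
    have "?c d = d" "?c (Suc m) = Suc d"
      using p by (auto simp: cyc_apply)
    then have inv: "inv ?c d = d" "inv ?c (Suc d) = Suc m"
      using c by (metis S_inf_inv_apply(2))+
    have "d < Suc m"
      using p by simp
    moreover have "cyc (Suc p) m = transpose d (Suc d) \<circ> ?c"
      using cyc_Suc[OF p(2)] p(3) by simp
    ultimately have "div_diff (VZ d) (VZ (Suc d)) (schubert_xz (cyc (Suc p) m)) = - schubert_xz ?c"
      using div_diff_z_schubert_xz[of "transpose d (Suc d) \<circ> ?c" d] c assms(1) p inv
      by (simp add: inv_adj_comp)
    then show ?thesis
      using p by (simp add: fact_elem_def nat_add_distrib)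
  qed
qed

lemma div_diff_z_fact_elem_y:
  assumes "1 \<le> d" "int m - q = int d"
  shows "div_diff (VZ d) (VZ (Suc d)) (fact_elem_y (q + 1) m A) = - fact_elem_y q m A"
proof -
  have "div_diff (VZ d) (VZ (Suc d)) (fact_elem_y (q + 1) m A) =
      subst (\<lambda>v. case v of
                  VX i \<Rightarrow> if 1 \<le> i \<and> i \<le> m then Var (VY (sorted_list_of_set A ! (i - 1))) else Var v
                | _ \<Rightarrow> Var v) (div_diff (VZ d) (VZ (Suc d)) (fact_elem (q + 1) m))"
    unfolding fact_elem_y_def by (rule div_diff_subst) (auto simp: transpose_def split: var.split)
  then show ?thesis
    by (simp add: div_diff_z_fact_elem[OF assms] fact_elem_y_def)
qed

lemma fact_elem_y_full:
  assumes "finite A"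
  shows "fact_elem_y (int (card A)) (card A) A = (\<Prod>c\<in>A. Var (VY c) - Var (VZ 1))"
proof -
  let ?l = "sorted_list_of_set A"
  have bij: "bij_betw (\<lambda>i. ?l ! (i - 1)) {1..card A} A"
  proof (rule bij_betw_trans[of "\<lambda>i. i - 1" _ "{..<card A}" "(!) ?l", unfolded o_def])
    show "bij_betw (\<lambda>i. i - 1) {1..card A} {..<card A}"
      by (rule bij_betw_byWitness[where f' = Suc]) auto
    show "bij_betw ((!) ?l) {..<card A} A"
      using assms by (intro bij_betw_nth) auto
  qed
  have "fact_elem_y (int (card A)) (card A) A =
      (\<Prod>i\<in>{1..card A}. Var (VY (?l ! (i - 1))) - Var (VZ 1))"
    unfolding fact_elem_y_def fact_elem_full top_factorial_def by simp
  also have "\<dots> = (\<Prod>c\<in>A. Var (VY c) - Var (VZ 1))"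
    by (rule prod.reindex_bij_betw[OF bij])
  finally show ?thesis .
qed

section \<open>The Pieri formula\<close>

lemma swap_var_z_schubert:
  assumes "u \<in> S_inf"
  shows "swap_var (VZ i) (VZ j) (schubert u) = schubert u"
  using subst_schubert_cong[OF assms, of "\<lambda>v. Var (transpose (VZ i) (VZ j) v)" Var]
  by (simp add: swap_var_def subst_Var transpose_def)

theorem theorem7p1:
  fixes u :: "nat \<Rightarrow> nat" and k :: nat and p :: int
  assumes "u \<in> S_inf" and "1 \<le> k" and "p \<le> int k"
  shows "schubert u * fact_elem p k =
    (\<Sum>w\<in>{w \<in> S_inf. pieri_rel k u w}.
       fact_elem_y (p - len_diff u w) (nat (int k - len_diff u w)) (P_set k u w) * schubert w)"
proof -
  have W: "{w \<in> S_inf. pieri_rel k u w} = {w. pieri_rel k u w}"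
    using pieri_rel_in_S_inf assms(1) by blast
  \<comment> \<open>Induction on d = k - p, one divided difference in z per step; large d covers
    negative p.\<close>
  have "schubert u * fact_elem (int k - int d) k =
    (\<Sum>w | pieri_rel k u w.
       fact_elem_y (int k - int d - len_diff u w) (nat (int k - len_diff u w)) (P_set k u w) * schubert w)" for d
  proof (induction d)
    case 0
    have "fact_elem_y (int k - int 0 - len_diff u w) (nat (int k - len_diff u w)) (P_set k u w) =
        pieri_coeff k u w" if w: "pieri_rel k u w" for w
    proof -
      obtain l where l: "l \<le> k" "len_diff u w = int l" "card (P_set k u w) = k - l"
        using pieri_rel_len[OF w assms(1)] by blast
      have "finite (P_set k u w)"
        by (simp add: P_set_def)
      then show ?thesis
        using fact_elem_y_full[of "P_set k u w"] l by (simp add: pieri_coeff_def of_nat_diff flip: of_nat_diff)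
    qed
    then show ?case
      using top_pieri[OF assms(1), of k] by (simp add: top_pieri_def fact_elem_full)
  next
    case (Suc d)
    let ?D = "div_diff (VZ (Suc d)) (VZ (Suc (Suc d)))"
    have D: "?D (schubert w * P) = schubert w * ?D P" if "w \<in> S_inf" for w P
      using swap_var_z_schubert[OF that] by (simp add: div_diff_mult_symmetric)
    have E: "?D (fact_elem_y (int k - int d - len_diff u w) (nat (int k - len_diff u w)) (P_set k u w)) =
        - fact_elem_y (int k - int (Suc d) - len_diff u w) (nat (int k - len_diff u w)) (P_set k u w)"
      if w: "pieri_rel k u w" for w
    proof -
      \<comment> \<open>Since l = \<open>len_diff u w\<close> is at most k, \<open>nat\<close>
        truncates nothing, and the degree gap (k - l) - (k - (d + 1) - l) = d + 1 is the same for
        all w.\<close>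
      have "int (nat (int k - len_diff u w)) = int k - len_diff u w"
        using pieri_rel_len[OF w assms(1)] by auto
      moreover have "int k - int (Suc d) - len_diff u w + 1 = int k - int d - len_diff u w"
        by simp
      ultimately show ?thesis
        using div_diff_z_fact_elem_y[of "Suc d" "nat (int k - len_diff u w)" "int k - int (Suc d) - len_diff u w"]
        by (simp only:)
    qed
    have "?D (schubert u * fact_elem (int k - int d) k) = - (schubert u * fact_elem (int k - int (Suc d)) k)"
      using div_diff_z_fact_elem[of "Suc d" k "int k - int (Suc d)"] by (simp add: D assms(1))
    moreover have "?D (\<Sum>w | pieri_rel k u w.
        fact_elem_y (int k - int d - len_diff u w) (nat (int k - len_diff u w)) (P_set k u w) * schubert w) =
      (\<Sum>w | pieri_rel k u w.
        - (fact_elem_y (int k - int (Suc d) - len_diff u w) (nat (int k - len_diff u w)) (P_set k u w) * schubert w))"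
      by (subst div_diff_sum, simp, intro sum.cong)
        (use E D pieri_rel_in_S_inf assms(1) in \<open>auto simp: mult.commute[of _ "schubert _"]\<close>)
    ultimately show ?case
      using Suc by (simp add: sum_negf)
  qed
  from this[of "nat (int k - p)"] show ?thesis
    using assms(3) by (simp add: W)
qed

end
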